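(* Let $\mathcal{G}$ be a groupoid. If $(A,\mathcal{G},\alpha,\beta)$ is an object crossed system, then $A\rtimes^\alpha_\beta\mathcal{G}$ is an object unital $\mathcal{G}$-graded ring which is an object crossed product. Conversely, any object crossed product can be presented in this way, i.e. every object unital $\mathcal{G}$-graded ring $R$ with $1_{R_e}\neq0$ for all $e\in\mathcal{G}_0$ which is an object crossed product is isomorphic, as a $\mathcal{G}$-graded ring, to $A\rtimes^\alpha_\beta\mathcal{G}$ for some object crossed system $(A,\mathcal{G},\alpha,\beta)$.
   Context: Rings are associative but not necessarily unital. A groupoid $\mathcal{G}$ is a small category in which every morphism is an isomorphism, identified with its set of morphisms; $d(\sigma)=\sigma^{-1}\sigma$, $r(\sigma)=\sigma\sigma^{-1}$; $\mathcal{G}_0$ is the set of identity elements; $\sigma\tau$ is defined iff $d(\sigma)=r(\tau)$; $\mathcal{G}_2$, $\mathcal{G}_3$ are the sets of composable pairs and triples. A ring $R$ is $\mathcal{G}$-graded if $R=\bigoplus_{\sigma\in\mathcal{G}}R_\sigma$ for additive subgroups $R_\sigma$ with $R_\sigma R_\tau\subseteq R_{\sigma\tau}$ if $(\sigma,\tau)\in\mathcal{G}_2$ and $R_\sigma R_\tau=\{0\}$ otherwise. It is object unital if each ring $R_e$, $e\in\mathcal{G}_0$, is unital and $1_{R_{r(\sigma)}}x=x1_{R_{d(\sigma)}}=x$ for all $\sigma\in\mathcal{G}$, $x\in R_\sigma$. Let $R$ be an object unital $\mathcal{G}$-graded ring. An element $x\in R_\sigma$ is object invertible if there is $y\in R_{\sigma^{-1}}$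 with $xy=1_{R_{r(\sigma)}}$ and $yx=1_{R_{d(\sigma)}}$. $R$ is an object crossed product if for every $\sigma\in\mathcal{G}$ the set $R_\sigma$ contains an object invertible element. An object crossed system $(A,\mathcal{G},\alpha,\beta)$ consists of a family $A=(A_e)_{e\in\mathcal{G}_0}$ of non-zero unital rings, unital ring isomorphisms $\alpha_\sigma:A_{d(\sigma)}\to A_{r(\sigma)}$ for $\sigma\in\mathcal{G}$, and units $\beta_{\sigma,\tau}\in U(A_{r(\sigma)})$ for $(\sigma,\tau)\in\mathcal{G}_2$, such that for all $(\sigma,\tau,\rho)\in\mathcal{G}_3$ and all $a\in A_{d(\tau)}$: (i) $\alpha_e=\mathrm{id}_{A_e}$ for $e\in\mathcal{G}_0$; (ii) $\beta_{\sigma,d(\sigma)}=\beta_{r(\sigma),\sigma}=1_{A_{r(\sigma)}}$; (iii) $\alpha_\sigma(\alpha_\tau(a))=\beta_{\sigma,\tau}\alpha_{\sigma\tau}(a)\beta_{\sigma,\tau}^{-1}$; (iv) $\beta_{\sigma,\tau}\beta_{\sigma\tau,\rho}=\alpha_\sigma(\beta_{\tau,\rho})\beta_{\sigma,\tau\rho}$. $A\rtimes^\alpha_\beta\mathcal{G}$ is the set of formal sums $\sum_{\sigma\in\mathcal{G}}a_\sigma u_\sigma$ with $a_\sigma\in A_{r(\sigma)}$, almost all zero, with componentwise addition and product the additive extension of $a_\sigma u_\sigma\cdot a'_\tau u_\tau=a_\sigma\alpha_\sigma(a'_\tau)\beta_{\sigma,\tau}u_{\sigma\tau}$ if $(\sigma,\tau)\in\mathcal{G}_2$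 and $0$ otherwise; its component of degree $\sigma$ is $A_{r(\sigma)}u_\sigma$. *)

theory Defs
  imports "HOL-Algebra.QuotRing"
begin

text \<open>A small category is given by its set of morphisms; objects are represented by their
  identity morphisms, so \<open>src\<close> and \<open>tgt\<close> (the maps $d$ and $r$) return morphisms, and
  \<open>cmp G \<sigma> \<tau>\<close> is meaningful only if \<open>src G \<sigma> = tgt G \<tau>\<close>.\<close>

record 'g category_data =
  Mor :: "'g set"
  src :: "'g \<Rightarrow> 'g"
  tgt :: "'g \<Rightarrow> 'g"
  cmp :: "'g \<Rightarrow> 'g \<Rightarrow> 'g"  (infixl \<open>\<cdot>\<index>\<close> 70)

definition Obj :: "('g, 'x) category_data_scheme \<Rightarrow> 'g set" where
  "Obj G = {e \<in> Mor G. src G e = e}"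

definition composable_pairs :: "('g, 'x) category_data_scheme \<Rightarrow> ('g \<times> 'g) set" where
  "composable_pairs G = {(\<sigma>, \<tau>). \<sigma> \<in> Mor G \<and> \<tau> \<in> Mor G \<and> src G \<sigma> = tgt G \<tau>}"

definition composable_triples :: "('g, 'x) category_data_scheme \<Rightarrow> ('g \<times> 'g \<times> 'g) set" where
  "composable_triples G =
     {(\<sigma>, \<tau>, \<rho>). (\<sigma>, \<tau>) \<in> composable_pairs G \<and> (\<tau>, \<rho>) \<in> composable_pairs G}"

definition is_inverse :: "('g, 'x) category_data_scheme \<Rightarrow> 'g \<Rightarrow> 'g \<Rightarrow> bool" where
  "is_inverse G \<sigma> \<tau> \<longleftrightarrow> (\<sigma>, \<tau>) \<in> composable_pairs G \<and> (\<tau>, \<sigma>) \<in> composable_pairs G \<and>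
     \<tau> \<cdot>\<^bsub>G\<^esub> \<sigma> = src G \<sigma> \<and> \<sigma> \<cdot>\<^bsub>G\<^esub> \<tau> = tgt G \<sigma>"

definition inverse_mor :: "('g, 'x) category_data_scheme \<Rightarrow> 'g \<Rightarrow> 'g" where
  "inverse_mor G \<sigma> = (THE \<tau>. is_inverse G \<sigma> \<tau>)"

locale small_category =
  fixes G :: "('g, 'x) category_data_scheme"
  assumes src_closed: "\<sigma> \<in> Mor G \<Longrightarrow> src G \<sigma> \<in> Mor G"
    and tgt_closed: "\<sigma> \<in> Mor G \<Longrightarrow> tgt G \<sigma> \<in> Mor G"
    and src_src: "\<sigma> \<in> Mor G \<Longrightarrow> src G (src G \<sigma>) = src G \<sigma>"
    and tgt_src: "\<sigma> \<in> Mor G \<Longrightarrow> tgt G (src G \<sigma>) = src G \<sigma>"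
    and src_tgt: "\<sigma> \<in> Mor G \<Longrightarrow> src G (tgt G \<sigma>) = tgt G \<sigma>"
    and tgt_tgt: "\<sigma> \<in> Mor G \<Longrightarrow> tgt G (tgt G \<sigma>) = tgt G \<sigma>"
    and cmp_closed: "(\<sigma>, \<tau>) \<in> composable_pairs G \<Longrightarrow> \<sigma> \<cdot>\<^bsub>G\<^esub> \<tau> \<in> Mor G"
    and src_cmp: "(\<sigma>, \<tau>) \<in> composable_pairs G \<Longrightarrow> src G (\<sigma> \<cdot>\<^bsub>G\<^esub> \<tau>) = src G \<tau>"
    and tgt_cmp: "(\<sigma>, \<tau>) \<in> composable_pairs G \<Longrightarrow> tgt G (\<sigma> \<cdot>\<^bsub>G\<^esub> \<tau>) = tgt G \<sigma>"
    and cmp_assoc: "(\<sigma>, \<tau>, \<rho>) \<in> composable_triples G \<Longrightarrow>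
           (\<sigma> \<cdot>\<^bsub>G\<^esub> \<tau>) \<cdot>\<^bsub>G\<^esub> \<rho> = \<sigma> \<cdot>\<^bsub>G\<^esub> (\<tau> \<cdot>\<^bsub>G\<^esub> \<rho>)"
    and cmp_src: "\<sigma> \<in> Mor G \<Longrightarrow> \<sigma> \<cdot>\<^bsub>G\<^esub> src G \<sigma> = \<sigma>"
    and tgt_cmp_self: "\<sigma> \<in> Mor G \<Longrightarrow> tgt G \<sigma> \<cdot>\<^bsub>G\<^esub> \<sigma> = \<sigma>"

locale groupoid = small_category +
  assumes inverse_exists: "\<sigma> \<in> Mor G \<Longrightarrow> \<exists>\<tau>. is_inverse G \<sigma> \<tau>"
begin

lemma inverse_unique:
  assumes "is_inverse G \<sigma> \<tau>" and "is_inverse G \<sigma> \<tau>'"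
  shows "\<tau> = \<tau>'"
proof -
  have pairs: "(\<tau>, \<sigma>) \<in> composable_pairs G" "(\<sigma>, \<tau>') \<in> composable_pairs G"
    and eqs: "\<tau> \<cdot>\<^bsub>G\<^esub> \<sigma> = src G \<sigma>" "\<sigma> \<cdot>\<^bsub>G\<^esub> \<tau>' = tgt G \<sigma>"
    using assms by (auto simp: is_inverse_def)
  have "\<tau> = \<tau> \<cdot>\<^bsub>G\<^esub> (\<sigma> \<cdot>\<^bsub>G\<^esub> \<tau>')"
    using pairs eqs cmp_src[of \<tau>] by (auto simp: composable_pairs_def)
  also have "\<dots> = (\<tau> \<cdot>\<^bsub>G\<^esub> \<sigma>) \<cdot>\<^bsub>G\<^esub> \<tau>'"
    using pairs cmp_assoc[of \<tau> \<sigma> \<tau>'] by (auto simp: composable_triples_def)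
  also have "\<dots> = \<tau>'"
    using pairs eqs tgt_cmp_self[of \<tau>'] by (auto simp: composable_pairs_def)
  finally show ?thesis .
qed

lemma is_inverse_inverse_mor: "\<sigma> \<in> Mor G \<Longrightarrow> is_inverse G \<sigma> (inverse_mor G \<sigma>)"
  unfolding inverse_mor_def using inverse_exists inverse_unique by (metis the_equality)

end

text \<open>The library locale \<open>ring\<close> is unital; here the \<open>one\<close> field of the record is
  unconstrained and never used for \<open>R\<close>.\<close>

locale assoc_ring = abelian_group R for R (structure) +
  assumes mult_closed: "\<lbrakk>x \<in> carrier R; y \<in> carrier R\<rbrakk> \<Longrightarrow> x \<otimes> y \<in> carrier R"
    and mult_assoc: "\<lbrakk>x \<in> carrier R; y \<in> carrier R; z \<in> carrier R\<rbrakk> \<Longrightarrow>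
           (x \<otimes> y) \<otimes> z = x \<otimes> (y \<otimes> z)"
    and distrib_right: "\<lbrakk>x \<in> carrier R; y \<in> carrier R; z \<in> carrier R\<rbrakk> \<Longrightarrow>
           (x \<oplus> y) \<otimes> z = x \<otimes> z \<oplus> y \<otimes> z"
    and distrib_left: "\<lbrakk>x \<in> carrier R; y \<in> carrier R; z \<in> carrier R\<rbrakk> \<Longrightarrow>
           z \<otimes> (x \<oplus> y) = z \<otimes> x \<oplus> z \<otimes> y"

locale groupoid_graded_ring = groupoid G + assoc_ring R
  for G :: "('g, 'x) category_data_scheme"
    and R :: "('r, 'k) ring_scheme" (structure)
    and C :: "'g \<Rightarrow> 'r set" +
  assumes component_subgroup: "\<sigma> \<in> Mor G \<Longrightarrow> additive_subgroup (C \<sigma>) R"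
    and direct_sum: "x \<in> carrier R \<Longrightarrow>
           \<exists>!f. f \<in> (\<Pi>\<^sub>E \<sigma>\<in>Mor G. C \<sigma>) \<and> finite {\<sigma> \<in> Mor G. f \<sigma> \<noteq> \<zero>} \<and>
                x = (\<Oplus>\<sigma>\<in>{\<sigma> \<in> Mor G. f \<sigma> \<noteq> \<zero>}. f \<sigma>)"
    and mult_composable: "\<lbrakk>(\<sigma>, \<tau>) \<in> composable_pairs G; x \<in> C \<sigma>; y \<in> C \<tau>\<rbrakk> \<Longrightarrow>
           x \<otimes> y \<in> C (\<sigma> \<cdot>\<^bsub>G\<^esub> \<tau>)"
    and mult_not_composable: "\<lbrakk>\<sigma> \<in> Mor G; \<tau> \<in> Mor G; (\<sigma>, \<tau>) \<notin> composable_pairs G;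
           x \<in> C \<sigma>; y \<in> C \<tau>\<rbrakk> \<Longrightarrow> x \<otimes> y = \<zero>"

definition is_identity_of :: "('r, 'k) ring_scheme \<Rightarrow> 'r set \<Rightarrow> 'r \<Rightarrow> bool" where
  "is_identity_of R S u \<longleftrightarrow> u \<in> S \<and> (\<forall>x\<in>S. u \<otimes>\<^bsub>R\<^esub> x = x \<and> x \<otimes>\<^bsub>R\<^esub> u = x)"

definition identity_of :: "('r, 'k) ring_scheme \<Rightarrow> 'r set \<Rightarrow> 'r" where
  "identity_of R S = (THE u. is_identity_of R S u)"

lemma identity_of_eq: "is_identity_of R S u \<Longrightarrow> identity_of R S = u"
  unfolding identity_of_def by (rule the_equality) (metis is_identity_of_def)+

locale object_unital_graded_ring = groupoid_graded_ring +
  assumes component_unital: "e \<in> Obj G \<Longrightarrow> \<exists>u. is_identity_of R (C e) u"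
    and identity_mult: "\<lbrakk>\<sigma> \<in> Mor G; x \<in> C \<sigma>\<rbrakk> \<Longrightarrow> identity_of R (C (tgt G \<sigma>)) \<otimes> x = x"
    and mult_identity: "\<lbrakk>\<sigma> \<in> Mor G; x \<in> C \<sigma>\<rbrakk> \<Longrightarrow> x \<otimes> identity_of R (C (src G \<sigma>)) = x"

definition object_invertible ::
  "('g, 'x) category_data_scheme \<Rightarrow> ('r, 'k) ring_scheme \<Rightarrow> ('g \<Rightarrow> 'r set) \<Rightarrow> 'g \<Rightarrow> 'r \<Rightarrow> bool" where
  "object_invertible G R C \<sigma> x \<longleftrightarrow> x \<in> C \<sigma> \<and>
     (\<exists>y \<in> C (inverse_mor G \<sigma>). x \<otimes>\<^bsub>R\<^esub> y = identity_of R (C (tgt G \<sigma>)) \<and>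
                                 y \<otimes>\<^bsub>R\<^esub> x = identity_of R (C (src G \<sigma>)))"

locale object_crossed_product = object_unital_graded_ring +
  assumes invertible_exists: "\<sigma> \<in> Mor G \<Longrightarrow> \<exists>x \<in> C \<sigma>. object_invertible G R C \<sigma> x"

definition graded_ring_iso ::
  "('g, 'x) category_data_scheme \<Rightarrow> ('r, 'k) ring_scheme \<Rightarrow> ('g \<Rightarrow> 'r set) \<Rightarrow>
   ('s, 'l) ring_scheme \<Rightarrow> ('g \<Rightarrow> 's set) \<Rightarrow> ('r \<Rightarrow> 's) set" where
  "graded_ring_iso G R C S D =
     {h. h \<in> iso (add_monoid R) (add_monoid S) \<and> h \<in> hom R S \<and> (\<forall>\<sigma>\<in>Mor G. h ` C \<sigma> = D \<sigma>)}"

locale object_crossed_system = groupoid G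
  for G :: "('g, 'x) category_data_scheme" +
  fixes A :: "'g \<Rightarrow> ('a, 'm) ring_scheme"
    and \<alpha> :: "'g \<Rightarrow> 'a \<Rightarrow> 'a"
    and \<beta> :: "'g \<Rightarrow> 'g \<Rightarrow> 'a"
  assumes unital_ring: "e \<in> Obj G \<Longrightarrow> ring (A e)"
    and nonzero: "e \<in> Obj G \<Longrightarrow> carrier (A e) \<noteq> {\<zero>\<^bsub>A e\<^esub>}"
    and \<alpha>_iso: "\<sigma> \<in> Mor G \<Longrightarrow> \<alpha> \<sigma> \<in> ring_iso (A (src G \<sigma>)) (A (tgt G \<sigma>))"
    and \<beta>_unit: "(\<sigma>, \<tau>) \<in> composable_pairs G \<Longrightarrow> \<beta> \<sigma> \<tau> \<in> Units (A (tgt G \<sigma>))"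
    and \<alpha>_identity: "\<lbrakk>e \<in> Obj G; a \<in> carrier (A e)\<rbrakk> \<Longrightarrow> \<alpha> e a = a"
    and \<beta>_src: "\<sigma> \<in> Mor G \<Longrightarrow> \<beta> \<sigma> (src G \<sigma>) = \<one>\<^bsub>A (tgt G \<sigma>)\<^esub>"
    and \<beta>_tgt: "\<sigma> \<in> Mor G \<Longrightarrow> \<beta> (tgt G \<sigma>) \<sigma> = \<one>\<^bsub>A (tgt G \<sigma>)\<^esub>"
    and \<alpha>_\<alpha>: "\<lbrakk>(\<sigma>, \<tau>) \<in> composable_pairs G; a \<in> carrier (A (src G \<tau>))\<rbrakk> \<Longrightarrow>
           \<alpha> \<sigma> (\<alpha> \<tau> a) =
             \<beta> \<sigma> \<tau> \<otimes>\<^bsub>A (tgt G \<sigma>)\<^esub> \<alpha> (\<sigma> \<cdot>\<^bsub>G\<^esub> \<tau>) a \<otimes>\<^bsub>A (tgt G \<sigma>)\<^esub> inv\<^bsub>A (tgt G \<sigma>)\<^esub> \<beta> \<sigma> \<tau>"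
    and \<beta>_cocycle: "(\<sigma>, \<tau>, \<rho>) \<in> composable_triples G \<Longrightarrow>
           \<beta> \<sigma> \<tau> \<otimes>\<^bsub>A (tgt G \<sigma>)\<^esub> \<beta> (\<sigma> \<cdot>\<^bsub>G\<^esub> \<tau>) \<rho> =
             \<alpha> \<sigma> (\<beta> \<tau> \<rho>) \<otimes>\<^bsub>A (tgt G \<sigma>)\<^esub> \<beta> \<sigma> (\<tau> \<cdot>\<^bsub>G\<^esub> \<rho>)"

text \<open>A formal sum $\sum_\sigma a_\sigma u_\sigma$ is its coefficient function, made
  \<open>undefined\<close> outside \<open>Mor G\<close>.\<close>

definition support ::
  "('g, 'x) category_data_scheme \<Rightarrow> ('g \<Rightarrow> ('a, 'm) ring_scheme) \<Rightarrow> ('g \<Rightarrow> 'a) \<Rightarrow> 'g set" where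
  "support G A a = {\<sigma> \<in> Mor G. a \<sigma> \<noteq> \<zero>\<^bsub>A (tgt G \<sigma>)\<^esub>}"

definition monomial ::
  "('g, 'x) category_data_scheme \<Rightarrow> ('g \<Rightarrow> ('a, 'm) ring_scheme) \<Rightarrow> 'a \<Rightarrow> 'g \<Rightarrow> ('g \<Rightarrow> 'a)" where
  "monomial G A a \<sigma> = (\<lambda>\<tau>\<in>Mor G. if \<tau> = \<sigma> then a else \<zero>\<^bsub>A (tgt G \<tau>)\<^esub>)"

text \<open>The coefficient of \<open>a \<otimes> b\<close> at \<open>\<rho>\<close> collects all products
  $a_\sigma u_\sigma \cdot b_\tau u_\tau = a_\sigma\alpha_\sigma(b_\tau)\beta_{\sigma,\tau}u_{\sigma\tau}$
  with $\sigma\tau = \rho$. The ring need not be unital, so its \<open>one\<close> field carries no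
  information.\<close>

definition crossed_product ::
  "('g, 'x) category_data_scheme \<Rightarrow> ('g \<Rightarrow> ('a, 'm) ring_scheme) \<Rightarrow>
   ('g \<Rightarrow> 'a \<Rightarrow> 'a) \<Rightarrow> ('g \<Rightarrow> 'g \<Rightarrow> 'a) \<Rightarrow> ('g \<Rightarrow> 'a) ring" where
  "crossed_product G A \<alpha> \<beta> =
     \<lparr> carrier = {a \<in> (\<Pi>\<^sub>E \<sigma>\<in>Mor G. carrier (A (tgt G \<sigma>))). finite (support G A a)},
       mult = (\<lambda>a b. \<lambda>\<rho>\<in>Mor G.
         finsum (A (tgt G \<rho>))
           (\<lambda>(\<sigma>, \<tau>). a \<sigma> \<otimes>\<^bsub>A (tgt G \<rho>)\<^esub> \<alpha> \<sigma> (b \<tau>) \<otimes>\<^bsub>A (tgt G \<rho>)\<^esub> \<beta> \<sigma> \<tau>)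
           {(\<sigma>, \<tau>) \<in> composable_pairs G.
              \<sigma> \<in> support G A a \<and> \<tau> \<in> support G A b \<and> \<sigma> \<cdot>\<^bsub>G\<^esub> \<tau> = \<rho>}),
       one = undefined,
       zero = (\<lambda>\<sigma>\<in>Mor G. \<zero>\<^bsub>A (tgt G \<sigma>)\<^esub>),
       add = (\<lambda>a b. \<lambda>\<sigma>\<in>Mor G. a \<sigma> \<oplus>\<^bsub>A (tgt G \<sigma>)\<^esub> b \<sigma>) \<rparr>"

definition crossed_component ::
  "('g, 'x) category_data_scheme \<Rightarrow> ('g \<Rightarrow> ('a, 'm) ring_scheme) \<Rightarrow> 'g \<Rightarrow> ('g \<Rightarrow> 'a) set" where
  "crossed_component G A \<sigma> = (\<lambda>a. monomial G A a \<sigma>) ` carrier (A (tgt G \<sigma>))"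

context object_crossed_system
begin

lemma ring_tgt: "\<sigma> \<in> Mor G \<Longrightarrow> ring (A (tgt G \<sigma>))"
  by (simp add: Obj_def unital_ring tgt_closed src_tgt)

lemma monomial_mult:
  assumes st: "(\<sigma>, \<tau>) \<in> composable_pairs G"
    and a: "a \<in> carrier (A (tgt G \<sigma>))" and b: "b \<in> carrier (A (tgt G \<tau>))"
  shows "monomial G A a \<sigma> \<otimes>\<^bsub>crossed_product G A \<alpha> \<beta>\<^esub> monomial G A b \<tau> =
    monomial G A (a \<otimes>\<^bsub>A (tgt G \<sigma>)\<^esub> \<alpha> \<sigma> b \<otimes>\<^bsub>A (tgt G \<sigma>)\<^esub> \<beta> \<sigma> \<tau>) (\<sigma> \<cdot>\<^bsub>G\<^esub> \<tau>)"
proof -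
  have mor: "\<sigma> \<in> Mor G" "\<tau> \<in> Mor G" "\<sigma> \<cdot>\<^bsub>G\<^esub> \<tau> \<in> Mor G" "src G \<sigma> = tgt G \<tau>"
    and tgt: "tgt G (\<sigma> \<cdot>\<^bsub>G\<^esub> \<tau>) = tgt G \<sigma>"
    using st cmp_closed tgt_cmp by (auto simp: composable_pairs_def)
  let ?S = "A (tgt G \<sigma>)"
  interpret S: ring ?S using ring_tgt mor by blast
  interpret T: ring "A (tgt G \<tau>)" using ring_tgt mor by blast
  have hom: "\<alpha> \<sigma> \<in> ring_hom (A (tgt G \<tau>)) ?S"
    using \<alpha>_iso[of \<sigma>] mor by (auto simp: ring_iso_def)
  have \<alpha>0: "\<alpha> \<sigma> \<zero>\<^bsub>A (tgt G \<tau>)\<^esub> = \<zero>\<^bsub>?S\<^esub>"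
    using hom ring_hom_zero[OF hom T.ring_axioms S.ring_axioms] by simp
  have \<alpha>b: "\<alpha> \<sigma> b \<in> carrier ?S" using hom b by (rule ring_hom_closed)
  have \<beta>: "\<beta> \<sigma> \<tau> \<in> carrier ?S" using \<beta>_unit[OF st] by (simp add: Units_def)
  let ?c = "a \<otimes>\<^bsub>?S\<^esub> \<alpha> \<sigma> b \<otimes>\<^bsub>?S\<^esub> \<beta> \<sigma> \<tau>"
  have zero: "?c = \<zero>\<^bsub>?S\<^esub>" if "a = \<zero>\<^bsub>?S\<^esub> \<or> b = \<zero>\<^bsub>A (tgt G \<tau>)\<^esub>"
    using that a b \<alpha>b \<beta> \<alpha>0 by auto
  have index: "{(\<sigma>', \<tau>') \<in> composable_pairs G. \<sigma>' \<in> support G A (monomial G A a \<sigma>) \<and>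
      \<tau>' \<in> support G A (monomial G A b \<tau>) \<and> \<sigma>' \<cdot>\<^bsub>G\<^esub> \<tau>' = \<rho>} =
     (if a = \<zero>\<^bsub>?S\<^esub> \<or> b = \<zero>\<^bsub>A (tgt G \<tau>)\<^esub> \<or> \<rho> \<noteq> \<sigma> \<cdot>\<^bsub>G\<^esub> \<tau> then {} else {(\<sigma>, \<tau>)})" for \<rho>
    using st mor by (auto simp: support_def monomial_def split: if_splits)
  show ?thesis
  proof
    fix \<rho>
    show "(monomial G A a \<sigma> \<otimes>\<^bsub>crossed_product G A \<alpha> \<beta>\<^esub> monomial G A b \<tau>) \<rho> =
      monomial G A ?c (\<sigma> \<cdot>\<^bsub>G\<^esub> \<tau>) \<rho>"
    proof (cases "\<rho> \<in> Mor G")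
      case True
      interpret P: ring "A (tgt G \<rho>)" using ring_tgt True by blast
      show ?thesis
        using True mor tgt zero a \<alpha>b \<beta> unfolding crossed_product_def
        by (auto simp: index P.finsum_empty S.finsum_insert) (auto simp: monomial_def)
    qed (simp add: crossed_product_def monomial_def)
  qed
qed

lemma monomial_mult_not_composable:
  assumes "\<sigma> \<in> Mor G" "\<tau> \<in> Mor G" "(\<sigma>, \<tau>) \<notin> composable_pairs G"
  shows "monomial G A a \<sigma> \<otimes>\<^bsub>crossed_product G A \<alpha> \<beta>\<^esub> monomial G A b \<tau> =
    \<zero>\<^bsub>crossed_product G A \<alpha> \<beta>\<^esub>"
proof -
  have index: "{(\<sigma>', \<tau>') \<in> composable_pairs G. \<sigma>' \<in> support G A (monomial G A a \<sigma>) \<and>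
      \<tau>' \<in> support G A (monomial G A b \<tau>) \<and> \<sigma>' \<cdot>\<^bsub>G\<^esub> \<tau>' = \<rho>} = {}" for \<rho>
    using assms by (auto simp: support_def monomial_def split: if_splits)
  have "finsum (A (tgt G \<rho>)) f {} = \<zero>\<^bsub>A (tgt G \<rho>)\<^esub>" if "\<rho> \<in> Mor G" for \<rho> and f :: "'g \<times> 'g \<Rightarrow> 'a"
    using ring_tgt[OF that] by (simp add: abelian_monoid.finsum_empty ring.is_abelian_group abelian_group.axioms)
  then show ?thesis
    unfolding crossed_product_def by (auto simp: index intro!: restrict_ext)
qed

end

end

theory Submission
  imports Defs
begin

text \<open>The crossed product is additively spanned by the monomials \<open>a u\<^sub>\<sigma>\<close> and its multiplication is
  biadditive, so associativity reduces to monomials, where it is the conjunction of the twisted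
  composition law for \<open>\<alpha>\<close> and the cocycle law for \<open>\<beta>\<close>.

  Conversely, choose in every component \<open>R\<^sub>\<sigma>\<close> an object invertible \<open>u\<^sub>\<sigma>\<close> with inverse \<open>v\<^sub>\<sigma>\<close>, taking
  \<open>u\<^sub>e = 1\<close> for identities \<open>e\<close>. Then \<open>A\<^sub>e = R\<^sub>e\<close>, \<open>\<alpha>\<^sub>\<sigma>(a) = u\<^sub>\<sigma> a v\<^sub>\<sigma>\<close> and
  \<open>\<beta>(\<sigma>,\<tau>) = u\<^sub>\<sigma> u\<^sub>\<tau> v\<^sub>\<sigma>\<^sub>\<tau>\<close> form an object crossed system, and since \<open>R\<^sub>\<sigma> = R\<^sub>r\<^sub>(\<^sub>\<sigma>\<^sub>) u\<^sub>\<sigma>\<close>, reading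
  formal sums as sums in \<open>R\<close> is a graded isomorphism.\<close>

section \<open>The crossed product of an object crossed system\<close>

context small_category
begin

lemma tgt_in_Obj: "\<sigma> \<in> Mor G \<Longrightarrow> tgt G \<sigma> \<in> Obj G"
  by (simp add: Obj_def tgt_closed src_tgt)

lemma src_in_Obj: "\<sigma> \<in> Mor G \<Longrightarrow> src G \<sigma> \<in> Obj G"
  by (simp add: Obj_def src_closed src_src)

lemma Obj_tgt: "e \<in> Obj G \<Longrightarrow> tgt G e = e"
  by (metis (mono_tags, lifting) Obj_def mem_Collect_eq tgt_src)

lemma Obj_cmp: "e \<in> Obj G \<Longrightarrow> e \<cdot>\<^bsub>G\<^esub> e = e"
  by (metis (mono_tags, lifting) Obj_def mem_Collect_eq cmp_src)

lemma composable_pairsD: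
  assumes "(\<sigma>, \<tau>) \<in> composable_pairs G"
  shows "\<sigma> \<in> Mor G" "\<tau> \<in> Mor G" "src G \<sigma> = tgt G \<tau>" "\<sigma> \<cdot>\<^bsub>G\<^esub> \<tau> \<in> Mor G"
    "tgt G (\<sigma> \<cdot>\<^bsub>G\<^esub> \<tau>) = tgt G \<sigma>" "src G (\<sigma> \<cdot>\<^bsub>G\<^esub> \<tau>) = src G \<tau>"
  using assms cmp_closed tgt_cmp src_cmp by (auto simp: composable_pairs_def)

end

lemma (in groupoid) inverse_morD:
  assumes "\<sigma> \<in> Mor G"
  shows "inverse_mor G \<sigma> \<in> Mor G" "src G (inverse_mor G \<sigma>) = tgt G \<sigma>"
    "tgt G (inverse_mor G \<sigma>) = src G \<sigma>" "inverse_mor G \<sigma> \<cdot>\<^bsub>G\<^esub> \<sigma> = src G \<sigma>"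
    "\<sigma> \<cdot>\<^bsub>G\<^esub> inverse_mor G \<sigma> = tgt G \<sigma>"
    "(\<sigma>, inverse_mor G \<sigma>) \<in> composable_pairs G" "(inverse_mor G \<sigma>, \<sigma>) \<in> composable_pairs G"
  using is_inverse_inverse_mor[OF assms] by (auto simp: is_inverse_def composable_pairs_def)

context object_crossed_system
begin

abbreviation P :: "('g \<Rightarrow> 'a) ring"
  where "P \<equiv> crossed_product G A \<alpha> \<beta>"

section \<open>The structure maps \<alpha> and \<beta>\<close>

lemma \<alpha>_hom: "\<sigma> \<in> Mor G \<Longrightarrow> \<alpha> \<sigma> \<in> ring_hom (A (src G \<sigma>)) (A (tgt G \<sigma>))"
  using \<alpha>_iso by (auto simp: ring_iso_def)

lemma \<beta>_closed: "(\<sigma>, \<tau>) \<in> composable_pairs G \<Longrightarrow> \<beta> \<sigma> \<tau> \<in> carrier (A (tgt G \<sigma>))"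
  using \<beta>_unit by (simp add: Units_def)

text \<open>The domain of \<open>\<alpha> \<sigma>\<close> is \<open>A (src G \<sigma>)\<close>.
  Along a composable pair this is the ring \<open>A (tgt G \<tau>)\<close> that holds the
  coefficient of the second factor, which is the form in which the product formula meets it.\<close>

lemma \<alpha>_closed:
  "(\<sigma>, \<tau>) \<in> composable_pairs G \<Longrightarrow> b \<in> carrier (A (tgt G \<tau>)) \<Longrightarrow> \<alpha> \<sigma> b \<in> carrier (A (tgt G \<sigma>))"
  using ring_hom_closed[OF \<alpha>_hom] by (auto simp: composable_pairs_def)

lemma \<alpha>_add:
  "(\<sigma>, \<tau>) \<in> composable_pairs G \<Longrightarrow> b \<in> carrier (A (tgt G \<tau>)) \<Longrightarrow> c \<in> carrier (A (tgt G \<tau>)) \<Longrightarrow>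
    \<alpha> \<sigma> (b \<oplus>\<^bsub>A (tgt G \<tau>)\<^esub> c) = \<alpha> \<sigma> b \<oplus>\<^bsub>A (tgt G \<sigma>)\<^esub> \<alpha> \<sigma> c"
  using ring_hom_add[OF \<alpha>_hom, of \<sigma>] by (auto simp: composable_pairs_def)

lemma \<alpha>_mult:
  "(\<sigma>, \<tau>) \<in> composable_pairs G \<Longrightarrow> b \<in> carrier (A (tgt G \<tau>)) \<Longrightarrow> c \<in> carrier (A (tgt G \<tau>)) \<Longrightarrow>
    \<alpha> \<sigma> (b \<otimes>\<^bsub>A (tgt G \<tau>)\<^esub> c) = \<alpha> \<sigma> b \<otimes>\<^bsub>A (tgt G \<sigma>)\<^esub> \<alpha> \<sigma> c"
  using ring_hom_mult[OF \<alpha>_hom, of \<sigma>] by (auto simp: composable_pairs_def)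

lemma \<alpha>_one: "(\<sigma>, \<tau>) \<in> composable_pairs G \<Longrightarrow> \<alpha> \<sigma> \<one>\<^bsub>A (tgt G \<tau>)\<^esub> = \<one>\<^bsub>A (tgt G \<sigma>)\<^esub>"
  using ring_hom_one[OF \<alpha>_hom, of \<sigma>] by (auto simp: composable_pairs_def)

lemma \<alpha>_zero: "(\<sigma>, \<tau>) \<in> composable_pairs G \<Longrightarrow> \<alpha> \<sigma> \<zero>\<^bsub>A (tgt G \<tau>)\<^esub> = \<zero>\<^bsub>A (tgt G \<sigma>)\<^esub>"
  using ring_hom_zero[OF \<alpha>_hom, of \<sigma>] ring_tgt[of \<sigma>] ring_tgt[of \<tau>]
  by (auto simp: composable_pairs_def)

section \<open>The additive group of formal sums\<close>

lemma P_carrier_iff: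
  "a \<in> carrier P \<longleftrightarrow> a \<in> (\<Pi>\<^sub>E \<sigma>\<in>Mor G. carrier (A (tgt G \<sigma>))) \<and> finite (support G A a)"
  by (simp add: crossed_product_def)

lemma P_closed: "a \<in> carrier P \<Longrightarrow> \<sigma> \<in> Mor G \<Longrightarrow> a \<sigma> \<in> carrier (A (tgt G \<sigma>))"
  by (auto simp: P_carrier_iff)

lemma P_add_apply: "\<sigma> \<in> Mor G \<Longrightarrow> (a \<oplus>\<^bsub>P\<^esub> b) \<sigma> = a \<sigma> \<oplus>\<^bsub>A (tgt G \<sigma>)\<^esub> b \<sigma>"
  by (simp add: crossed_product_def)

lemma P_zero_apply: "\<sigma> \<in> Mor G \<Longrightarrow> \<zero>\<^bsub>P\<^esub> \<sigma> = \<zero>\<^bsub>A (tgt G \<sigma>)\<^esub>"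
  by (simp add: crossed_product_def)

lemma P_ext:
  "a \<in> carrier P \<Longrightarrow> b \<in> carrier P \<Longrightarrow> (\<And>\<sigma>. \<sigma> \<in> Mor G \<Longrightarrow> a \<sigma> = b \<sigma>) \<Longrightarrow> a = b"
  by (auto simp: P_carrier_iff intro: PiE_ext)

lemma support_subset: "support G A a \<subseteq> Mor G"
  by (auto simp: support_def)

lemma support_finite: "a \<in> carrier P \<Longrightarrow> finite (support G A a)"
  by (simp add: P_carrier_iff)

lemma support_add: "support G A (a \<oplus>\<^bsub>P\<^esub> b) \<subseteq> support G A a \<union> support G A b"
proof
  fix \<sigma> assume s: "\<sigma> \<in> support G A (a \<oplus>\<^bsub>P\<^esub> b)"
  then have m: "\<sigma> \<in> Mor G" by (simp add: support_def)
  interpret ring "A (tgt G \<sigma>)" using m by (rule ring_tgt)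
  show "\<sigma> \<in> support G A a \<union> support G A b"
    using s m by (auto simp: support_def P_add_apply)
qed

lemma P_zero_closed: "\<zero>\<^bsub>P\<^esub> \<in> carrier P"
  using ring.ring_simprules(2)[OF ring_tgt]
  by (auto simp: P_carrier_iff support_def P_zero_apply) (auto simp: crossed_product_def)

lemma P_add_closed: "a \<in> carrier P \<Longrightarrow> b \<in> carrier P \<Longrightarrow> a \<oplus>\<^bsub>P\<^esub> b \<in> carrier P"
  using finite_subset[OF support_add, of a b] ring.ring_simprules(1)[OF ring_tgt]
  unfolding P_carrier_iff by (auto simp: PiE_iff extensional_def crossed_product_def)

lemma P_abelian_group: "abelian_group P"
proof (rule abelian_groupI)
  fix x y z assume x: "x \<in> carrier P" and y: "y \<in> carrier P" and z: "z \<in> carrier P"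
  show "x \<oplus>\<^bsub>P\<^esub> y \<oplus>\<^bsub>P\<^esub> z = x \<oplus>\<^bsub>P\<^esub> (y \<oplus>\<^bsub>P\<^esub> z)"
  proof (rule P_ext)
    fix \<sigma> assume m: "\<sigma> \<in> Mor G"
    interpret ring "A (tgt G \<sigma>)" using m by (rule ring_tgt)
    show "(x \<oplus>\<^bsub>P\<^esub> y \<oplus>\<^bsub>P\<^esub> z) \<sigma> = (x \<oplus>\<^bsub>P\<^esub> (y \<oplus>\<^bsub>P\<^esub> z)) \<sigma>"
      using P_closed m x y z by (simp add: P_add_apply a_assoc)
  qed (simp_all add: P_add_closed x y z)
next
  fix x y assume x: "x \<in> carrier P" and y: "y \<in> carrier P"
  show "x \<oplus>\<^bsub>P\<^esub> y = y \<oplus>\<^bsub>P\<^esub> x"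
  proof (rule P_ext)
    fix \<sigma> assume m: "\<sigma> \<in> Mor G"
    interpret ring "A (tgt G \<sigma>)" using m by (rule ring_tgt)
    show "(x \<oplus>\<^bsub>P\<^esub> y) \<sigma> = (y \<oplus>\<^bsub>P\<^esub> x) \<sigma>"
      using P_closed m x y by (simp add: P_add_apply a_comm)
  qed (simp_all add: P_add_closed x y)
next
  fix x assume x: "x \<in> carrier P"
  show "\<zero>\<^bsub>P\<^esub> \<oplus>\<^bsub>P\<^esub> x = x"
  proof (rule P_ext)
    fix \<sigma> assume m: "\<sigma> \<in> Mor G"
    interpret ring "A (tgt G \<sigma>)" using m by (rule ring_tgt)
    show "(\<zero>\<^bsub>P\<^esub> \<oplus>\<^bsub>P\<^esub> x) \<sigma> = x \<sigma>"
      using P_closed m x by (simp add: P_add_apply P_zero_apply)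
  qed (simp_all add: P_add_closed P_zero_closed x)
  let ?y = "\<lambda>\<sigma>\<in>Mor G. \<ominus>\<^bsub>A (tgt G \<sigma>)\<^esub> x \<sigma>"
  \<comment> \<open>The middle equivalence says that the pointwise negative vanishes exactly where
    \<open>x\<close> does, so it inherits finite support.\<close>
  have neg: "?y \<sigma> \<in> carrier (A (tgt G \<sigma>)) \<and> (?y \<sigma> = \<zero>\<^bsub>A (tgt G \<sigma>)\<^esub> \<longleftrightarrow> x \<sigma> = \<zero>\<^bsub>A (tgt G \<sigma>)\<^esub>) \<and>
    ?y \<sigma> \<oplus>\<^bsub>A (tgt G \<sigma>)\<^esub> x \<sigma> = \<zero>\<^bsub>A (tgt G \<sigma>)\<^esub>" if m: "\<sigma> \<in> Mor G" for \<sigma>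
  proof -
    interpret ring "A (tgt G \<sigma>)" using m by (rule ring_tgt)
    have "x \<sigma> \<in> carrier (A (tgt G \<sigma>))" by (rule P_closed[OF x m])
    then show ?thesis using m l_neg by (auto simp: minus_minus[symmetric])
  qed
  then have "support G A ?y = support G A x" by (auto simp: support_def)
  with neg support_finite[OF x] have y: "?y \<in> carrier P" by (auto simp: P_carrier_iff)
  have "?y \<oplus>\<^bsub>P\<^esub> x = \<zero>\<^bsub>P\<^esub>"
    using neg by (intro P_ext) (auto simp: P_add_closed P_zero_closed x y P_add_apply P_zero_apply)
  with y show "\<exists>y\<in>carrier P. y \<oplus>\<^bsub>P\<^esub> x = \<zero>\<^bsub>P\<^esub>" by blast
qed (simp_all add: P_add_closed P_zero_closed)

interpretation P: abelian_group P
  by (rule P_abelian_group)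

section \<open>Multiplication as a convolution\<close>

definition conv_index :: "'g set \<Rightarrow> 'g set \<Rightarrow> 'g \<Rightarrow> ('g \<times> 'g) set" where
  "conv_index F H \<rho> = {(\<sigma>, \<tau>) \<in> composable_pairs G. \<sigma> \<in> F \<and> \<tau> \<in> H \<and> \<sigma> \<cdot>\<^bsub>G\<^esub> \<tau> = \<rho>}"

definition conv_term :: "('g \<Rightarrow> 'a) \<Rightarrow> ('g \<Rightarrow> 'a) \<Rightarrow> 'g \<Rightarrow> 'g \<times> 'g \<Rightarrow> 'a" where
  "conv_term a b \<rho> = (\<lambda>(\<sigma>, \<tau>). a \<sigma> \<otimes>\<^bsub>A (tgt G \<rho>)\<^esub> \<alpha> \<sigma> (b \<tau>) \<otimes>\<^bsub>A (tgt G \<rho>)\<^esub> \<beta> \<sigma> \<tau>)"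

lemma conv_index_finite: "finite F \<Longrightarrow> finite H \<Longrightarrow> finite (conv_index F H \<rho>)"
  by (rule finite_subset[of _ "F \<times> H"]) (auto simp: conv_index_def)

lemma conv_term_closed:
  assumes "a \<in> carrier P" "b \<in> carrier P"
  shows "conv_term a b \<rho> \<in> conv_index F H \<rho> \<rightarrow> carrier (A (tgt G \<rho>))"
proof
  fix p assume "p \<in> conv_index F H \<rho>"
  then obtain \<sigma> \<tau> where p: "p = (\<sigma>, \<tau>)" and c: "(\<sigma>, \<tau>) \<in> composable_pairs G" and r: "\<rho> = \<sigma> \<cdot>\<^bsub>G\<^esub> \<tau>"
    by (auto simp: conv_index_def)
  note d = composable_pairsD[OF c]
  interpret ring "A (tgt G \<sigma>)" by (rule ring_tgt[OF d(1)])
  show "conv_term a b \<rho> p \<in> carrier (A (tgt G \<rho>))"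
    using d r assms \<alpha>_closed[OF c] \<beta>_closed[OF c] P_closed by (simp add: p conv_term_def)
qed

text \<open>Enlarging the summation range to one common to several factors makes the product visibly
  additive in both arguments.\<close>

lemma P_mult_apply:
  assumes a: "a \<in> carrier P" and b: "b \<in> carrier P" and r: "\<rho> \<in> Mor G"
    and F: "finite F" "support G A a \<subseteq> F" "F \<subseteq> Mor G"
    and H: "finite H" "support G A b \<subseteq> H" "H \<subseteq> Mor G"
  shows "(a \<otimes>\<^bsub>P\<^esub> b) \<rho> = finsum (A (tgt G \<rho>)) (conv_term a b \<rho>) (conv_index F H \<rho>)"
proof -
  interpret ring "A (tgt G \<rho>)" using r by (rule ring_tgt)
  have "(a \<otimes>\<^bsub>P\<^esub> b) \<rho> =
    finsum (A (tgt G \<rho>)) (conv_term a b \<rho>) (conv_index (support G A a) (support G A b) \<rho>)"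
    using r by (simp add: crossed_product_def conv_term_def conv_index_def)
  also have "\<dots> = finsum (A (tgt G \<rho>)) (conv_term a b \<rho>) (conv_index F H \<rho>)"
  proof (rule add.finprod_mono_neutral_cong_left)
    show "finite (conv_index F H \<rho>)" using F H by (simp add: conv_index_finite)
    show "conv_index (support G A a) (support G A b) \<rho> \<subseteq> conv_index F H \<rho>"
      using F H by (auto simp: conv_index_def)
    show "conv_term a b \<rho> \<in> conv_index F H \<rho> \<rightarrow> carrier (A (tgt G \<rho>))"
      by (rule conv_term_closed[OF a b])
  next
    fix p assume "p \<in> conv_index F H \<rho> - conv_index (support G A a) (support G A b) \<rho>"
    then obtain \<sigma> \<tau> where p: "p = (\<sigma>, \<tau>)" and c: "(\<sigma>, \<tau>) \<in> composable_pairs G"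
      and rr: "\<rho> = \<sigma> \<cdot>\<^bsub>G\<^esub> \<tau>" and n: "\<sigma> \<notin> support G A a \<or> \<tau> \<notin> support G A b"
      by (auto simp: conv_index_def)
    note d = composable_pairsD[OF c]
    interpret S: ring "A (tgt G \<sigma>)" by (rule ring_tgt[OF d(1)])
    \<comment> \<open>An index outside one of the supports makes one coefficient zero. Since
      \<open>\<alpha> \<sigma>\<close> preserves zero, the whole term vanishes even if the zero sits
      in the second factor.\<close>
    have "a \<sigma> = \<zero>\<^bsub>A (tgt G \<sigma>)\<^esub> \<or> b \<tau> = \<zero>\<^bsub>A (tgt G \<tau>)\<^esub>"
      using n d by (auto simp: support_def)
    then show "conv_term a b \<rho> p = \<zero>\<^bsub>A (tgt G \<rho>)\<^esub>"
      using d rr \<alpha>_closed[OF c, of "b \<tau>"] \<beta>_closed[OF c] P_closed[OF a, of \<sigma>] P_closed[OF b, of \<tau>]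
      by (auto simp: p conv_term_def \<alpha>_zero[OF c])
  qed simp
  finally show ?thesis .
qed

lemma P_mult_closed:
  assumes a: "a \<in> carrier P" and b: "b \<in> carrier P"
  shows "a \<otimes>\<^bsub>P\<^esub> b \<in> carrier P"
proof -
  let ?F = "support G A a" and ?H = "support G A b"
  have eq: "(a \<otimes>\<^bsub>P\<^esub> b) \<rho> = finsum (A (tgt G \<rho>)) (conv_term a b \<rho>) (conv_index ?F ?H \<rho>)"
    if "\<rho> \<in> Mor G" for \<rho>
    by (rule P_mult_apply[OF a b that]) (use support_finite[OF a] support_finite[OF b] in \<open>auto simp: support_subset\<close>)
  have "(a \<otimes>\<^bsub>P\<^esub> b) \<rho> \<in> carrier (A (tgt G \<rho>))" if r: "\<rho> \<in> Mor G" for \<rho>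
  proof -
    interpret ring "A (tgt G \<rho>)" using r by (rule ring_tgt)
    show ?thesis using eq[OF r] finsum_closed[OF conv_term_closed[OF a b]] by simp
  qed
  moreover have "(a \<otimes>\<^bsub>P\<^esub> b) \<rho> = undefined" if "\<rho> \<notin> Mor G" for \<rho>
    using that by (simp add: crossed_product_def)
  \<comment> \<open>A nonzero coefficient at \<open>\<rho>\<close> cannot be an empty sum, so
    \<open>\<rho>\<close> is a composite of elements of the two supports, and there are finitely
    many such composites.\<close>
  moreover have "support G A (a \<otimes>\<^bsub>P\<^esub> b) \<subseteq> (\<lambda>(\<sigma>, \<tau>). \<sigma> \<cdot>\<^bsub>G\<^esub> \<tau>) ` (?F \<times> ?H)"
  proof
    fix \<rho> assume r: "\<rho> \<in> support G A (a \<otimes>\<^bsub>P\<^esub> b)"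
    then have m: "\<rho> \<in> Mor G" by (simp add: support_def)
    interpret ring "A (tgt G \<rho>)" using m by (rule ring_tgt)
    have "conv_index ?F ?H \<rho> \<noteq> {}" using r m eq[OF m] by (auto simp: support_def)
    then show "\<rho> \<in> (\<lambda>(\<sigma>, \<tau>). \<sigma> \<cdot>\<^bsub>G\<^esub> \<tau>) ` (?F \<times> ?H)" by (force simp: conv_index_def)
  qed
  then have "finite (support G A (a \<otimes>\<^bsub>P\<^esub> b))"
    by (rule finite_subset) (simp add: support_finite a b)
  ultimately show ?thesis by (auto simp: P_carrier_iff)
qed

lemma conv_index_composable:
  assumes "p \<in> conv_index F H \<rho>"
  obtains \<sigma> \<tau> where "p = (\<sigma>, \<tau>)" "(\<sigma>, \<tau>) \<in> composable_pairs G" "\<rho> = \<sigma> \<cdot>\<^bsub>G\<^esub> \<tau>"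
  using assms by (auto simp: conv_index_def)

lemma P_distrib_right:
  assumes x: "x \<in> carrier P" and y: "y \<in> carrier P" and z: "z \<in> carrier P"
  shows "(x \<oplus>\<^bsub>P\<^esub> y) \<otimes>\<^bsub>P\<^esub> z = x \<otimes>\<^bsub>P\<^esub> z \<oplus>\<^bsub>P\<^esub> y \<otimes>\<^bsub>P\<^esub> z"
proof (rule P_ext)
  fix \<rho> assume r: "\<rho> \<in> Mor G"
  interpret ring "A (tgt G \<rho>)" using r by (rule ring_tgt)
  \<comment> \<open>This union also contains the support of \<open>x \<oplus> y\<close>, so all
    three products are sums over one index set and can be compared term by term.\<close>
  let ?F = "support G A x \<union> support G A y" and ?H = "support G A z"
  note fin = support_finite[OF x] support_finite[OF y] support_finite[OF z]
  have eq: "(w \<otimes>\<^bsub>P\<^esub> z) \<rho> = finsum (A (tgt G \<rho>)) (conv_term w z \<rho>) (conv_index ?F ?H \<rho>)"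
    if "w \<in> carrier P" "support G A w \<subseteq> ?F" for w
    by (rule P_mult_apply[OF that(1) z r]) (use that fin in \<open>auto simp: support_subset\<close>)
  have "((x \<oplus>\<^bsub>P\<^esub> y) \<otimes>\<^bsub>P\<^esub> z) \<rho> =
    finsum (A (tgt G \<rho>)) (conv_term (x \<oplus>\<^bsub>P\<^esub> y) z \<rho>) (conv_index ?F ?H \<rho>)"
    by (rule eq) (simp_all add: P_add_closed x y support_add)
  also have "\<dots> = finsum (A (tgt G \<rho>))
      (\<lambda>p. conv_term x z \<rho> p \<oplus>\<^bsub>A (tgt G \<rho>)\<^esub> conv_term y z \<rho> p) (conv_index ?F ?H \<rho>)"
  proof (rule finsum_cong')
    fix p assume "p \<in> conv_index ?F ?H \<rho>"
    then obtain \<sigma> \<tau> where p: "p = (\<sigma>, \<tau>)" and c: "(\<sigma>, \<tau>) \<in> composable_pairs G"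
      and rr: "\<rho> = \<sigma> \<cdot>\<^bsub>G\<^esub> \<tau>" by (rule conv_index_composable)
    note d = composable_pairsD[OF c]
    interpret S: ring "A (tgt G \<sigma>)" by (rule ring_tgt[OF d(1)])
    show "conv_term (x \<oplus>\<^bsub>P\<^esub> y) z \<rho> p = conv_term x z \<rho> p \<oplus>\<^bsub>A (tgt G \<rho>)\<^esub> conv_term y z \<rho> p"
      using d rr P_closed[OF x d(1)] P_closed[OF y d(1)] \<alpha>_closed[OF c P_closed[OF z d(2)]] \<beta>_closed[OF c]
      by (simp add: p conv_term_def P_add_apply S.l_distr)
  qed (auto intro!: funcset_mem[OF conv_term_closed] x y z)
  also have "\<dots> = (x \<otimes>\<^bsub>P\<^esub> z) \<rho> \<oplus>\<^bsub>A (tgt G \<rho>)\<^esub> (y \<otimes>\<^bsub>P\<^esub> z) \<rho>"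
    by (simp add: eq x y finsum_addf conv_term_closed z)
  finally show "((x \<oplus>\<^bsub>P\<^esub> y) \<otimes>\<^bsub>P\<^esub> z) \<rho> = (x \<otimes>\<^bsub>P\<^esub> z \<oplus>\<^bsub>P\<^esub> y \<otimes>\<^bsub>P\<^esub> z) \<rho>"
    by (simp add: P_add_apply r)
qed (simp_all add: P_add_closed P_mult_closed x y z)

text \<open>The sum now stands in the second factor, so additivity of
  \<open>\<alpha> \<sigma>\<close> is used besides distributivity in the coefficient ring.\<close>

lemma P_distrib_left:
  assumes x: "x \<in> carrier P" and y: "y \<in> carrier P" and z: "z \<in> carrier P"
  shows "z \<otimes>\<^bsub>P\<^esub> (x \<oplus>\<^bsub>P\<^esub> y) = z \<otimes>\<^bsub>P\<^esub> x \<oplus>\<^bsub>P\<^esub> z \<otimes>\<^bsub>P\<^esub> y"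
proof (rule P_ext)
  fix \<rho> assume r: "\<rho> \<in> Mor G"
  interpret ring "A (tgt G \<rho>)" using r by (rule ring_tgt)
  let ?F = "support G A x \<union> support G A y" and ?H = "support G A z"
  note fin = support_finite[OF x] support_finite[OF y] support_finite[OF z]
  have eq: "(z \<otimes>\<^bsub>P\<^esub> w) \<rho> = finsum (A (tgt G \<rho>)) (conv_term z w \<rho>) (conv_index ?H ?F \<rho>)"
    if "w \<in> carrier P" "support G A w \<subseteq> ?F" for w
    by (rule P_mult_apply[OF z that(1) r]) (use that fin in \<open>auto simp: support_subset\<close>)
  have "(z \<otimes>\<^bsub>P\<^esub> (x \<oplus>\<^bsub>P\<^esub> y)) \<rho> =
    finsum (A (tgt G \<rho>)) (conv_term z (x \<oplus>\<^bsub>P\<^esub> y) \<rho>) (conv_index ?H ?F \<rho>)"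
    by (rule eq) (simp_all add: P_add_closed x y support_add)
  also have "\<dots> = finsum (A (tgt G \<rho>))
      (\<lambda>p. conv_term z x \<rho> p \<oplus>\<^bsub>A (tgt G \<rho>)\<^esub> conv_term z y \<rho> p) (conv_index ?H ?F \<rho>)"
  proof (rule finsum_cong')
    fix p assume "p \<in> conv_index ?H ?F \<rho>"
    then obtain \<sigma> \<tau> where p: "p = (\<sigma>, \<tau>)" and c: "(\<sigma>, \<tau>) \<in> composable_pairs G"
      and rr: "\<rho> = \<sigma> \<cdot>\<^bsub>G\<^esub> \<tau>" by (rule conv_index_composable)
    note d = composable_pairsD[OF c]
    interpret S: ring "A (tgt G \<sigma>)" by (rule ring_tgt[OF d(1)])
    show "conv_term z (x \<oplus>\<^bsub>P\<^esub> y) \<rho> p = conv_term z x \<rho> p \<oplus>\<^bsub>A (tgt G \<rho>)\<^esub> conv_term z y \<rho> p"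
      using d rr P_closed[OF x d(2)] P_closed[OF y d(2)] P_closed[OF z d(1)] \<alpha>_closed[OF c] \<beta>_closed[OF c]
      by (simp add: p conv_term_def P_add_apply S.l_distr S.r_distr \<alpha>_add[OF c])
  qed (auto intro!: funcset_mem[OF conv_term_closed] x y z)
  also have "\<dots> = (z \<otimes>\<^bsub>P\<^esub> x) \<rho> \<oplus>\<^bsub>A (tgt G \<rho>)\<^esub> (z \<otimes>\<^bsub>P\<^esub> y) \<rho>"
    by (simp add: eq x y finsum_addf conv_term_closed z)
  finally show "(z \<otimes>\<^bsub>P\<^esub> (x \<oplus>\<^bsub>P\<^esub> y)) \<rho> = (z \<otimes>\<^bsub>P\<^esub> x \<oplus>\<^bsub>P\<^esub> z \<otimes>\<^bsub>P\<^esub> y) \<rho>"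
    by (simp add: P_add_apply r)
qed (simp_all add: P_add_closed P_mult_closed x y z)

text \<open>Biadditivity suffices: a product with zero equals its own double, and cancellation in
  the additive group makes it zero. This serves the zero case of the inductions that establish
  associativity.\<close>

lemma P_mult_zero:
  assumes x: "x \<in> carrier P"
  shows "x \<otimes>\<^bsub>P\<^esub> \<zero>\<^bsub>P\<^esub> = \<zero>\<^bsub>P\<^esub>" "\<zero>\<^bsub>P\<^esub> \<otimes>\<^bsub>P\<^esub> x = \<zero>\<^bsub>P\<^esub>"
proof -
  show "x \<otimes>\<^bsub>P\<^esub> \<zero>\<^bsub>P\<^esub> = \<zero>\<^bsub>P\<^esub>"
    using P_distrib_left[of "\<zero>\<^bsub>P\<^esub>" "\<zero>\<^bsub>P\<^esub>" x] x P_mult_closed[of x "\<zero>\<^bsub>P\<^esub>"] P.add.l_cancel_one' by auto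
  show "\<zero>\<^bsub>P\<^esub> \<otimes>\<^bsub>P\<^esub> x = \<zero>\<^bsub>P\<^esub>"
    using P_distrib_right[of "\<zero>\<^bsub>P\<^esub>" "\<zero>\<^bsub>P\<^esub>" x] x P_mult_closed[of "\<zero>\<^bsub>P\<^esub>" x] P.add.l_cancel_one' by auto
qed

section \<open>Monomials as additive generators\<close>

lemma monomial_closed:
  assumes "\<sigma> \<in> Mor G" "a \<in> carrier (A (tgt G \<sigma>))"
  shows "monomial G A a \<sigma> \<in> carrier P"
proof -
  have "support G A (monomial G A a \<sigma>) \<subseteq> {\<sigma>}"
    by (auto simp: support_def monomial_def split: if_splits)
  then have "finite (support G A (monomial G A a \<sigma>))" by (rule finite_subset) simp
  then show ?thesis
    using assms ring.ring_simprules(2)[OF ring_tgt]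
    by (auto simp: P_carrier_iff monomial_def)
qed

lemma monomial_apply: "\<tau> \<in> Mor G \<Longrightarrow> monomial G A a \<sigma> \<tau> = (if \<tau> = \<sigma> then a else \<zero>\<^bsub>A (tgt G \<tau>)\<^esub>)"
  by (simp add: monomial_def)

text \<open>Reads off the coefficients of a finite sum of monomials in distinct degrees. It yields
  both the existence of the homogeneous decomposition and, later, its uniqueness.\<close>

lemma finsum_monomial:
  assumes "finite F" "F \<subseteq> Mor G" "\<And>\<sigma>. \<sigma> \<in> F \<Longrightarrow> c \<sigma> \<in> carrier (A (tgt G \<sigma>))" "\<tau> \<in> Mor G"
  shows "(\<Oplus>\<^bsub>P\<^esub>\<sigma>\<in>F. monomial G A (c \<sigma>) \<sigma>) \<tau> = (if \<tau> \<in> F then c \<tau> else \<zero>\<^bsub>A (tgt G \<tau>)\<^esub>)"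
  using assms(1-3)
proof (induction F rule: finite_induct)
  case empty
  then show ?case using assms(4) by (simp add: P_zero_apply)
next
  case (insert \<sigma> F)
  interpret ring "A (tgt G \<tau>)" using assms(4) by (rule ring_tgt)
  interpret S: ring "A (tgt G \<sigma>)" using insert.prems by (intro ring_tgt) auto
  have "(\<Oplus>\<^bsub>P\<^esub>\<sigma>\<in>insert \<sigma> F. monomial G A (c \<sigma>) \<sigma>) =
      monomial G A (c \<sigma>) \<sigma> \<oplus>\<^bsub>P\<^esub> (\<Oplus>\<^bsub>P\<^esub>\<sigma>\<in>F. monomial G A (c \<sigma>) \<sigma>)"
    using insert.hyps insert.prems by (intro P.finsum_insert) (auto intro!: monomial_closed)
  moreover have "(\<Oplus>\<^bsub>P\<^esub>\<sigma>\<in>F. monomial G A (c \<sigma>) \<sigma>) \<tau> = (if \<tau> \<in> F then c \<tau> else \<zero>\<^bsub>A (tgt G \<tau>)\<^esub>)"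
    using insert by auto
  ultimately show ?case
    using assms(4) insert.hyps insert.prems(2)[of \<tau>] by (auto simp: P_add_apply monomial_apply)
qed

lemma sum_of_monomials:
  assumes "a \<in> carrier P"
  shows "a = (\<Oplus>\<^bsub>P\<^esub>\<sigma>\<in>support G A a. monomial G A (a \<sigma>) \<sigma>)"
proof (rule P_ext[OF assms])
  note c = P_closed[OF assms subsetD[OF support_subset]]
  show "(\<Oplus>\<^bsub>P\<^esub>\<sigma>\<in>support G A a. monomial G A (a \<sigma>) \<sigma>) \<in> carrier P"
    using c support_subset[of a] by (intro P.finsum_closed) (auto intro!: monomial_closed)
  fix \<tau> assume t: "\<tau> \<in> Mor G"
  have "(\<Oplus>\<^bsub>P\<^esub>\<sigma>\<in>support G A a. monomial G A (a \<sigma>) \<sigma>) \<tau> =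
      (if \<tau> \<in> support G A a then a \<tau> else \<zero>\<^bsub>A (tgt G \<tau>)\<^esub>)"
    by (rule finsum_monomial) (use t c support_finite[OF assms] support_subset in auto)
  then show "a \<tau> = (\<Oplus>\<^bsub>P\<^esub>\<sigma>\<in>support G A a. monomial G A (a \<sigma>) \<sigma>) \<tau>"
    using t by (auto simp: support_def)
qed

text \<open>Every element is the sum of its own monomials over its finite support, so a property
  stable under sums only has to be checked on zero and on monomials.\<close>

lemma P_induct [consumes 1, case_names zero monomial add]:
  assumes a: "a \<in> carrier P"
    and zero: "Q \<zero>\<^bsub>P\<^esub>"
    and mono: "\<And>\<sigma> c. \<sigma> \<in> Mor G \<Longrightarrow> c \<in> carrier (A (tgt G \<sigma>)) \<Longrightarrow> Q (monomial G A c \<sigma>)"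
    and add: "\<And>x y. x \<in> carrier P \<Longrightarrow> y \<in> carrier P \<Longrightarrow> Q x \<Longrightarrow> Q y \<Longrightarrow> Q (x \<oplus>\<^bsub>P\<^esub> y)"
  shows "Q a"
proof -
  \<comment> \<open>The index set is generalized from the support of \<open>a\<close> to any finite
    set of morphisms, with the coefficients of \<open>a\<close> kept fixed, so that set induction
    can remove one degree at a time.\<close>
  have "Q (\<Oplus>\<^bsub>P\<^esub>\<sigma>\<in>F. monomial G A (a \<sigma>) \<sigma>)" if "finite F" "F \<subseteq> Mor G" for F
    using that
  proof (induction F rule: finite_induct)
    case empty
    then show ?case using zero by simp
  next
    case (insert \<sigma> F)
    have cl: "monomial G A (a \<tau>) \<tau> \<in> carrier P" if "\<tau> \<in> insert \<sigma> F" for \<tau>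
      using that insert.prems a by (auto intro!: monomial_closed P_closed)
    have eq: "(\<Oplus>\<^bsub>P\<^esub>\<sigma>\<in>insert \<sigma> F. monomial G A (a \<sigma>) \<sigma>) =
        monomial G A (a \<sigma>) \<sigma> \<oplus>\<^bsub>P\<^esub> (\<Oplus>\<^bsub>P\<^esub>\<sigma>\<in>F. monomial G A (a \<sigma>) \<sigma>)"
      using insert.hyps cl by (intro P.finsum_insert) auto
    show ?case unfolding eq
      using insert cl by (intro add mono) (auto intro!: P.finsum_closed P_closed[OF a])
  qed
  from this[OF support_finite[OF a] support_subset] show ?thesis
    using sum_of_monomials[OF a] by simp
qed

section \<open>Associativity\<close>

lemma monomial_assoc:
  assumes m: "\<sigma> \<in> Mor G" "\<tau> \<in> Mor G" "\<rho> \<in> Mor G"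
    and a: "a \<in> carrier (A (tgt G \<sigma>))" and b: "b \<in> carrier (A (tgt G \<tau>))" and c: "c \<in> carrier (A (tgt G \<rho>))"
  shows "monomial G A a \<sigma> \<otimes>\<^bsub>P\<^esub> monomial G A b \<tau> \<otimes>\<^bsub>P\<^esub> monomial G A c \<rho> =
    monomial G A a \<sigma> \<otimes>\<^bsub>P\<^esub> (monomial G A b \<tau> \<otimes>\<^bsub>P\<^esub> monomial G A c \<rho>)"
proof -
  note mc = monomial_closed[OF m(1) a] monomial_closed[OF m(2) b] monomial_closed[OF m(3) c]
  interpret S: ring "A (tgt G \<sigma>)" using m by (intro ring_tgt)
  interpret T: ring "A (tgt G \<tau>)" using m by (intro ring_tgt)
  consider (both) "(\<sigma>, \<tau>) \<in> composable_pairs G" "(\<tau>, \<rho>) \<in> composable_pairs G"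
    | (left) "(\<sigma>, \<tau>) \<in> composable_pairs G" "(\<tau>, \<rho>) \<notin> composable_pairs G"
    | (right) "(\<sigma>, \<tau>) \<notin> composable_pairs G" "(\<tau>, \<rho>) \<in> composable_pairs G"
    | (none) "(\<sigma>, \<tau>) \<notin> composable_pairs G" "(\<tau>, \<rho>) \<notin> composable_pairs G"
    by blast
  then show ?thesis
  proof cases
    case both
    note d = composable_pairsD[OF both(1)] and e = composable_pairsD[OF both(2)]
    have st: "(\<sigma> \<cdot>\<^bsub>G\<^esub> \<tau>, \<rho>) \<in> composable_pairs G" and tr: "(\<sigma>, \<tau> \<cdot>\<^bsub>G\<^esub> \<rho>) \<in> composable_pairs G"
      and tri: "(\<sigma>, \<tau>, \<rho>) \<in> composable_triples G"
      using d e both by (auto simp: composable_pairs_def composable_triples_def)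
    let ?S = "A (tgt G \<sigma>)"
    define b' where "b' = \<alpha> \<sigma> b"
    define c' where "c' = \<alpha> (\<sigma> \<cdot>\<^bsub>G\<^esub> \<tau>) c"
    have b': "b' \<in> carrier ?S" unfolding b'_def by (rule \<alpha>_closed[OF both(1) b])
    have c': "c' \<in> carrier ?S" unfolding c'_def using \<alpha>_closed[OF st c] d by simp
    have tc: "\<alpha> \<tau> c \<in> carrier (A (tgt G \<tau>))" by (rule \<alpha>_closed[OF both(2) c])
    have U: "\<beta> \<sigma> \<tau> \<in> Units ?S" by (rule \<beta>_unit[OF both(1)])
    note B = \<beta>_closed[OF both(1)] \<beta>_closed[OF both(2)] \<beta>_closed[OF tr]
    have B': "\<beta> (\<sigma> \<cdot>\<^bsub>G\<^esub> \<tau>) \<rho> \<in> carrier ?S" using \<beta>_closed[OF st] d by simp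
    note iv = S.Units_inv_closed[OF U]
    have ab: "\<alpha> \<sigma> (\<beta> \<tau> \<rho>) \<in> carrier ?S" by (rule \<alpha>_closed[OF both(1) B(2)])
    have aa: "\<alpha> \<sigma> (\<alpha> \<tau> c) = \<beta> \<sigma> \<tau> \<otimes>\<^bsub>?S\<^esub> c' \<otimes>\<^bsub>?S\<^esub> inv\<^bsub>?S\<^esub> \<beta> \<sigma> \<tau>"
      unfolding c'_def using \<alpha>_\<alpha>[OF both(1), of c] c e by simp
    \<comment> \<open>The twisted composition law for
      \<open>\<alpha> \<sigma> (\<alpha> \<tau> c)\<close> leaves the inverse of
      \<open>\<beta> \<sigma> \<tau>\<close> directly in front of the right side of the cocycle
      identity. Replacing that by the left side, which begins with
      \<open>\<beta> \<sigma> \<tau>\<close>, lets the inverse cancel.\<close>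
    have "a \<otimes>\<^bsub>?S\<^esub> \<alpha> \<sigma> (b \<otimes>\<^bsub>A (tgt G \<tau>)\<^esub> \<alpha> \<tau> c \<otimes>\<^bsub>A (tgt G \<tau>)\<^esub> \<beta> \<tau> \<rho>) \<otimes>\<^bsub>?S\<^esub> \<beta> \<sigma> (\<tau> \<cdot>\<^bsub>G\<^esub> \<rho>)
      = a \<otimes>\<^bsub>?S\<^esub> (b' \<otimes>\<^bsub>?S\<^esub> (\<beta> \<sigma> \<tau> \<otimes>\<^bsub>?S\<^esub> (c' \<otimes>\<^bsub>?S\<^esub> (inv\<^bsub>?S\<^esub> \<beta> \<sigma> \<tau> \<otimes>\<^bsub>?S\<^esub>
          (\<alpha> \<sigma> (\<beta> \<tau> \<rho>) \<otimes>\<^bsub>?S\<^esub> \<beta> \<sigma> (\<tau> \<cdot>\<^bsub>G\<^esub> \<rho>))))))"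
      using a b tc B b' c' iv ab
      by (simp add: \<alpha>_mult[OF both(1)] aa b'_def[symmetric] S.m_assoc)
    also have "\<dots> = a \<otimes>\<^bsub>?S\<^esub> (b' \<otimes>\<^bsub>?S\<^esub> (\<beta> \<sigma> \<tau> \<otimes>\<^bsub>?S\<^esub> (c' \<otimes>\<^bsub>?S\<^esub> (inv\<^bsub>?S\<^esub> \<beta> \<sigma> \<tau> \<otimes>\<^bsub>?S\<^esub>
          (\<beta> \<sigma> \<tau> \<otimes>\<^bsub>?S\<^esub> \<beta> (\<sigma> \<cdot>\<^bsub>G\<^esub> \<tau>) \<rho>)))))"
      using \<beta>_cocycle[OF tri] by simp
    also have "inv\<^bsub>?S\<^esub> \<beta> \<sigma> \<tau> \<otimes>\<^bsub>?S\<^esub> (\<beta> \<sigma> \<tau> \<otimes>\<^bsub>?S\<^esub> \<beta> (\<sigma> \<cdot>\<^bsub>G\<^esub> \<tau>) \<rho>) = \<beta> (\<sigma> \<cdot>\<^bsub>G\<^esub> \<tau>) \<rho>"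
      using iv B B' U by (simp add: S.m_assoc[symmetric])
    finally have key: "a \<otimes>\<^bsub>?S\<^esub> b' \<otimes>\<^bsub>?S\<^esub> \<beta> \<sigma> \<tau> \<otimes>\<^bsub>?S\<^esub> c' \<otimes>\<^bsub>?S\<^esub> \<beta> (\<sigma> \<cdot>\<^bsub>G\<^esub> \<tau>) \<rho> =
        a \<otimes>\<^bsub>?S\<^esub> \<alpha> \<sigma> (b \<otimes>\<^bsub>A (tgt G \<tau>)\<^esub> \<alpha> \<tau> c \<otimes>\<^bsub>A (tgt G \<tau>)\<^esub> \<beta> \<tau> \<rho>) \<otimes>\<^bsub>?S\<^esub> \<beta> \<sigma> (\<tau> \<cdot>\<^bsub>G\<^esub> \<rho>)"
      using a b' c' B B' by (simp add: S.m_assoc)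
    show ?thesis
      using key d e a b c b' tc B cmp_assoc[OF tri]
      by (simp add: monomial_mult both st tr b'_def c'_def)
  next
    case left
    note d = composable_pairsD[OF left(1)]
    \<comment> \<open>A composite has the source of its second factor, so multiplying by
      \<open>\<rho>\<close> still fails and both bracketings vanish. The mirrored case uses the
      target of the first factor.\<close>
    have "(\<sigma> \<cdot>\<^bsub>G\<^esub> \<tau>, \<rho>) \<notin> composable_pairs G" using left d m by (auto simp: composable_pairs_def)
    then show ?thesis
      using left d m mc a b by (simp add: monomial_mult monomial_mult_not_composable P_mult_zero)
  next
    case right
    note d = composable_pairsD[OF right(2)]
    have "(\<sigma>, \<tau> \<cdot>\<^bsub>G\<^esub> \<rho>) \<notin> composable_pairs G" using right d m by (auto simp: composable_pairs_def)
    then show ?thesis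
      using right d m mc b c by (simp add: monomial_mult monomial_mult_not_composable P_mult_zero)
  next
    case none
    then show ?thesis using m mc by (simp add: monomial_mult_not_composable P_mult_zero)
  qed
qed

text \<open>Both sides are additive in each of the three arguments. The arguments are generalized
  from monomials one at a time, from the right: first \<open>z\<close>, then \<open>y\<close>, then
  \<open>x\<close>.\<close>

lemma P_mult_assoc:
  assumes x: "x \<in> carrier P" and y: "y \<in> carrier P" and z: "z \<in> carrier P"
  shows "x \<otimes>\<^bsub>P\<^esub> y \<otimes>\<^bsub>P\<^esub> z = x \<otimes>\<^bsub>P\<^esub> (y \<otimes>\<^bsub>P\<^esub> z)"
proof -
  have 1: "monomial G A a \<sigma> \<otimes>\<^bsub>P\<^esub> monomial G A b \<tau> \<otimes>\<^bsub>P\<^esub> z = monomial G A a \<sigma> \<otimes>\<^bsub>P\<^esub> (monomial G A b \<tau> \<otimes>\<^bsub>P\<^esub> z)"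
    if m: "\<sigma> \<in> Mor G" "\<tau> \<in> Mor G" "a \<in> carrier (A (tgt G \<sigma>))" "b \<in> carrier (A (tgt G \<tau>))" for a b \<sigma> \<tau>
    using z
  proof (induction z rule: P_induct)
    case (monomial \<rho> c)
    then show ?case using m by (intro monomial_assoc)
  qed (simp_all add: P_mult_zero P_distrib_left P_mult_closed monomial_closed m)
  have 2: "monomial G A a \<sigma> \<otimes>\<^bsub>P\<^esub> y \<otimes>\<^bsub>P\<^esub> z = monomial G A a \<sigma> \<otimes>\<^bsub>P\<^esub> (y \<otimes>\<^bsub>P\<^esub> z)"
    if m: "\<sigma> \<in> Mor G" "a \<in> carrier (A (tgt G \<sigma>))" for a \<sigma>
    using y
  proof (induction y rule: P_induct)
    case (monomial \<tau> b)
    then show ?case using m by (intro 1)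
  qed (simp_all add: P_mult_zero P_distrib_left P_distrib_right P_mult_closed monomial_closed m z)
  show ?thesis using x
  proof (induction x rule: P_induct)
    case (monomial \<sigma> a)
    then show ?case by (rule 2)
  qed (simp_all add: P_mult_zero P_distrib_right P_mult_closed y z)
qed

lemma P_assoc_ring: "assoc_ring P"
  by unfold_locales (simp_all add: P_mult_closed P_mult_assoc P_distrib_right P_distrib_left)


section \<open>The grading of the crossed product\<close>

lemma monomial_eq_zero: "\<sigma> \<in> Mor G \<Longrightarrow> monomial G A c \<sigma> = \<zero>\<^bsub>P\<^esub> \<longleftrightarrow> c = \<zero>\<^bsub>A (tgt G \<sigma>)\<^esub>"
  by (auto simp: monomial_def crossed_product_def fun_eq_iff)

lemma monomial_add:
  assumes "\<sigma> \<in> Mor G" "a \<in> carrier (A (tgt G \<sigma>))" "b \<in> carrier (A (tgt G \<sigma>))"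
  shows "monomial G A a \<sigma> \<oplus>\<^bsub>P\<^esub> monomial G A b \<sigma> = monomial G A (a \<oplus>\<^bsub>A (tgt G \<sigma>)\<^esub> b) \<sigma>"
proof (rule P_ext)
  interpret ring "A (tgt G \<sigma>)" using assms(1) by (rule ring_tgt)
  show "monomial G A (a \<oplus>\<^bsub>A (tgt G \<sigma>)\<^esub> b) \<sigma> \<in> carrier P"
    using assms by (intro monomial_closed) auto
  fix \<tau> assume t: "\<tau> \<in> Mor G"
  interpret T: ring "A (tgt G \<tau>)" using t by (rule ring_tgt)
  show "(monomial G A a \<sigma> \<oplus>\<^bsub>P\<^esub> monomial G A b \<sigma>) \<tau> = monomial G A (a \<oplus>\<^bsub>A (tgt G \<sigma>)\<^esub> b) \<sigma> \<tau>"
    using t by (auto simp: P_add_apply monomial_apply)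
qed (simp add: P_add_closed monomial_closed assms)

lemma crossed_componentD:
  assumes "\<sigma> \<in> Mor G" "a \<in> crossed_component G A \<sigma>"
  shows "a \<sigma> \<in> carrier (A (tgt G \<sigma>))" "monomial G A (a \<sigma>) \<sigma> = a"
  using assms by (auto simp: crossed_component_def monomial_apply)

lemma crossed_component_subgroup:
  assumes m: "\<sigma> \<in> Mor G"
  shows "additive_subgroup (crossed_component G A \<sigma>) P"
proof (intro additive_subgroup.intro P.add.subgroupI)
  interpret ring "A (tgt G \<sigma>)" using m by (rule ring_tgt)
  show "crossed_component G A \<sigma> \<subseteq> carrier P"
    using m by (auto simp: crossed_component_def monomial_closed)
  show "crossed_component G A \<sigma> \<noteq> {}"
    by (auto simp: crossed_component_def)
  show "\<ominus>\<^bsub>P\<^esub> x \<in> crossed_component G A \<sigma>" if x: "x \<in> crossed_component G A \<sigma>" for x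
  proof -
    obtain a where a: "x = monomial G A a \<sigma>" "a \<in> carrier (A (tgt G \<sigma>))"
      using x by (auto simp: crossed_component_def)
    then have "monomial G A (\<ominus>\<^bsub>A (tgt G \<sigma>)\<^esub> a) \<sigma> \<oplus>\<^bsub>P\<^esub> x = \<zero>\<^bsub>P\<^esub>"
      using m by (simp add: monomial_add monomial_eq_zero l_neg)
    then have "\<ominus>\<^bsub>P\<^esub> x = monomial G A (\<ominus>\<^bsub>A (tgt G \<sigma>)\<^esub> a) \<sigma>"
      using a m by (intro P.minus_equality) (simp_all add: monomial_closed)
    then show ?thesis using a by (auto simp: crossed_component_def)
  qed
  show "x \<oplus>\<^bsub>P\<^esub> y \<in> crossed_component G A \<sigma>"
    if "x \<in> crossed_component G A \<sigma>" "y \<in> crossed_component G A \<sigma>" for x y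
    using that m by (auto simp: crossed_component_def monomial_add)
qed

text \<open>The part of degree \<open>\<sigma>\<close> has to be the monomial with coefficient
  \<open>x \<sigma>\<close>. Evaluating any decomposition \<open>f\<close> at \<open>\<tau>\<close>
  leaves only the coefficient of \<open>f \<tau>\<close>, which determines \<open>f\<close> on
  \<open>Mor G\<close>; extensionality determines it elsewhere.\<close>

lemma crossed_direct_sum:
  assumes x: "x \<in> carrier P"
  shows "\<exists>!f. f \<in> (\<Pi>\<^sub>E \<sigma>\<in>Mor G. crossed_component G A \<sigma>) \<and> finite {\<sigma> \<in> Mor G. f \<sigma> \<noteq> \<zero>\<^bsub>P\<^esub>} \<and>
    x = (\<Oplus>\<^bsub>P\<^esub>\<sigma>\<in>{\<sigma> \<in> Mor G. f \<sigma> \<noteq> \<zero>\<^bsub>P\<^esub>}. f \<sigma>)"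
proof (rule ex1I)
  let ?f = "\<lambda>\<sigma>\<in>Mor G. monomial G A (x \<sigma>) \<sigma>"
  have supp: "{\<sigma> \<in> Mor G. ?f \<sigma> \<noteq> \<zero>\<^bsub>P\<^esub>} = support G A x"
    by (auto simp: support_def monomial_eq_zero)
  have "(\<Oplus>\<^bsub>P\<^esub>\<sigma>\<in>support G A x. ?f \<sigma>) = (\<Oplus>\<^bsub>P\<^esub>\<sigma>\<in>support G A x. monomial G A (x \<sigma>) \<sigma>)"
    using support_subset[of x] by (intro P.finsum_cong') (auto intro!: monomial_closed P_closed x)
  then show "?f \<in> (\<Pi>\<^sub>E \<sigma>\<in>Mor G. crossed_component G A \<sigma>) \<and> finite {\<sigma> \<in> Mor G. ?f \<sigma> \<noteq> \<zero>\<^bsub>P\<^esub>} \<and>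
    x = (\<Oplus>\<^bsub>P\<^esub>\<sigma>\<in>{\<sigma> \<in> Mor G. ?f \<sigma> \<noteq> \<zero>\<^bsub>P\<^esub>}. ?f \<sigma>)"
    unfolding supp using sum_of_monomials[OF x] support_finite[OF x] P_closed[OF x]
    by (auto simp: crossed_component_def)
next
  fix f
  assume f: "f \<in> (\<Pi>\<^sub>E \<sigma>\<in>Mor G. crossed_component G A \<sigma>) \<and> finite {\<sigma> \<in> Mor G. f \<sigma> \<noteq> \<zero>\<^bsub>P\<^esub>} \<and>
    x = (\<Oplus>\<^bsub>P\<^esub>\<sigma>\<in>{\<sigma> \<in> Mor G. f \<sigma> \<noteq> \<zero>\<^bsub>P\<^esub>}. f \<sigma>)"
  let ?F = "{\<sigma> \<in> Mor G. f \<sigma> \<noteq> \<zero>\<^bsub>P\<^esub>}"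
  have c: "f \<sigma> \<sigma> \<in> carrier (A (tgt G \<sigma>))" "monomial G A (f \<sigma> \<sigma>) \<sigma> = f \<sigma>" if "\<sigma> \<in> Mor G" for \<sigma>
    using f crossed_componentD[OF that, of "f \<sigma>"] that by auto
  have "x = (\<Oplus>\<^bsub>P\<^esub>\<sigma>\<in>?F. f \<sigma>)"
    using f by blast
  also have "\<dots> = (\<Oplus>\<^bsub>P\<^esub>\<sigma>\<in>?F. monomial G A (f \<sigma> \<sigma>) \<sigma>)"
    using c by (intro P.finsum_cong') (auto intro!: monomial_closed)
  finally have x_eq: "x = (\<Oplus>\<^bsub>P\<^esub>\<sigma>\<in>?F. monomial G A (f \<sigma> \<sigma>) \<sigma>)" .
  have "f \<tau> = monomial G A (x \<tau>) \<tau>" if t: "\<tau> \<in> Mor G" for \<tau>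
  proof -
    have "x \<tau> = (if \<tau> \<in> ?F then f \<tau> \<tau> else \<zero>\<^bsub>A (tgt G \<tau>)\<^esub>)"
      by (subst x_eq, rule finsum_monomial) (use f c t in auto)
    moreover have "f \<tau> \<tau> = \<zero>\<^bsub>A (tgt G \<tau>)\<^esub>" if "\<tau> \<notin> ?F"
      using that t by (simp add: P_zero_apply)
    ultimately show ?thesis using c(2)[OF t] by auto
  qed
  moreover have "f \<in> extensional (Mor G)"
    using f by (simp add: PiE_iff)
  ultimately show "f = (\<lambda>\<sigma>\<in>Mor G. monomial G A (x \<sigma>) \<sigma>)"
    by (intro extensionalityI[OF _ restrict_extensional]) simp_all
qed

lemma crossed_product_graded: "groupoid_graded_ring G P (crossed_component G A)"
proof (intro groupoid_graded_ring.intro groupoid_graded_ring_axioms.intro)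
  fix \<sigma> \<tau> x y
  assume c: "(\<sigma>, \<tau>) \<in> composable_pairs G"
    and "x \<in> crossed_component G A \<sigma>" "y \<in> crossed_component G A \<tau>"
  then obtain a b where ab: "x = monomial G A a \<sigma>" "a \<in> carrier (A (tgt G \<sigma>))"
    "y = monomial G A b \<tau>" "b \<in> carrier (A (tgt G \<tau>))"
    by (auto simp: crossed_component_def)
  note d = composable_pairsD[OF c]
  interpret S: ring "A (tgt G \<sigma>)" by (rule ring_tgt[OF d(1)])
  show "x \<otimes>\<^bsub>P\<^esub> y \<in> crossed_component G A (\<sigma> \<cdot>\<^bsub>G\<^esub> \<tau>)"
    using ab d \<alpha>_closed[OF c] \<beta>_closed[OF c]
    by (auto simp: monomial_mult[OF c] crossed_component_def)
next
  fix \<sigma> \<tau> x y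
  assume "\<sigma> \<in> Mor G" "\<tau> \<in> Mor G" "(\<sigma>, \<tau>) \<notin> composable_pairs G"
    "x \<in> crossed_component G A \<sigma>" "y \<in> crossed_component G A \<tau>"
  then show "x \<otimes>\<^bsub>P\<^esub> y = \<zero>\<^bsub>P\<^esub>"
    by (auto simp: crossed_component_def monomial_mult_not_composable)
qed (simp_all add: crossed_component_subgroup crossed_direct_sum P_assoc_ring groupoid_axioms)

section \<open>Local identities and object invertible monomials\<close>

lemma monomial_one_mult:
  assumes m: "\<sigma> \<in> Mor G" and a: "a \<in> carrier (A (tgt G \<sigma>))"
  shows "monomial G A \<one>\<^bsub>A (tgt G \<sigma>)\<^esub> (tgt G \<sigma>) \<otimes>\<^bsub>P\<^esub> monomial G A a \<sigma> = monomial G A a \<sigma>"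
proof -
  interpret ring "A (tgt G \<sigma>)" using m by (rule ring_tgt)
  have c: "(tgt G \<sigma>, \<sigma>) \<in> composable_pairs G"
    using m by (simp add: composable_pairs_def tgt_closed src_tgt)
  show ?thesis
    using m a by (simp add: monomial_mult[OF c] tgt_tgt tgt_cmp_self \<beta>_tgt \<alpha>_identity tgt_in_Obj)
qed

text \<open>The coefficient of the product is \<open>a\<close> times
  \<open>\<alpha> \<sigma>\<close> of the identity times
  \<open>\<beta> \<sigma> (src G \<sigma>)\<close>; unitality of \<open>\<alpha> \<sigma>\<close>
  and the normalization of \<open>\<beta>\<close> make both extra factors one.\<close>

lemma monomial_mult_one:
  assumes m: "\<sigma> \<in> Mor G" and a: "a \<in> carrier (A (tgt G \<sigma>))"
  shows "monomial G A a \<sigma> \<otimes>\<^bsub>P\<^esub> monomial G A \<one>\<^bsub>A (src G \<sigma>)\<^esub> (src G \<sigma>) = monomial G A a \<sigma>"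
proof -
  interpret ring "A (tgt G \<sigma>)" using m by (rule ring_tgt)
  interpret D: ring "A (src G \<sigma>)" using m by (intro unital_ring src_in_Obj)
  have c: "(\<sigma>, src G \<sigma>) \<in> composable_pairs G"
    using m by (simp add: composable_pairs_def src_closed tgt_src)
  show ?thesis
    using m a \<alpha>_one[OF c] by (simp add: monomial_mult[OF c] tgt_src cmp_src \<beta>_src)
qed

lemma crossed_component_identity:
  assumes e: "e \<in> Obj G"
  shows "is_identity_of P (crossed_component G A e) (monomial G A \<one>\<^bsub>A e\<^esub> e)"
proof -
  have m: "e \<in> Mor G" "src G e = e" using e by (auto simp: Obj_def)
  interpret ring "A e" using e by (rule unital_ring)
  show ?thesis
    using monomial_one_mult[OF m(1)] monomial_mult_one[OF m(1)] m Obj_tgt[OF e]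
    by (auto simp: is_identity_of_def crossed_component_def)
qed

lemma identity_of_crossed_component:
  "e \<in> Obj G \<Longrightarrow> identity_of P (crossed_component G A e) = monomial G A \<one>\<^bsub>A e\<^esub> e"
  by (rule identity_of_eq[OF crossed_component_identity])

lemma crossed_product_object_unital: "object_unital_graded_ring G P (crossed_component G A)"
proof -
  interpret groupoid_graded_ring G P "crossed_component G A" by (rule crossed_product_graded)
  show ?thesis
  proof
    show "\<exists>u. is_identity_of P (crossed_component G A e) u" if "e \<in> Obj G" for e
      using crossed_component_identity[OF that] by blast
    show "identity_of P (crossed_component G A (tgt G \<sigma>)) \<otimes>\<^bsub>P\<^esub> x = x"
      if "\<sigma> \<in> Mor G" "x \<in> crossed_component G A \<sigma>" for \<sigma> x
      using that by (auto simp: crossed_component_def[of _ _ \<sigma>] tgt_in_Obj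
          identity_of_crossed_component monomial_one_mult)
    show "x \<otimes>\<^bsub>P\<^esub> identity_of P (crossed_component G A (src G \<sigma>)) = x"
      if "\<sigma> \<in> Mor G" "x \<in> crossed_component G A \<sigma>" for \<sigma> x
      using that by (auto simp: crossed_component_def[of _ _ \<sigma>] src_in_Obj
          identity_of_crossed_component monomial_mult_one)
  qed
qed

text \<open>The inverse of \<open>u\<^sub>\<sigma>\<close> is \<open>\<beta>(\<sigma>\<^sup>-\<^sup>1,\<sigma>)\<^sup>-\<^sup>1 u\<close> in degree \<open>\<sigma>\<^sup>-\<^sup>1\<close>; it is a two-sided inverse because the
  cocycle identity at \<open>(\<sigma>, \<sigma>\<^sup>-\<^sup>1, \<sigma>)\<close> reads \<open>\<beta>(\<sigma>,\<sigma>\<^sup>-\<^sup>1) = \<alpha>\<^sub>\<sigma>(\<beta>(\<sigma>\<^sup>-\<^sup>1,\<sigma>))\<close>.\<close>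

lemma monomial_one_invertible:
  assumes m: "\<sigma> \<in> Mor G"
  shows "object_invertible G P (crossed_component G A) \<sigma> (monomial G A \<one>\<^bsub>A (tgt G \<sigma>)\<^esub> \<sigma>)"
proof -
  let ?i = "inverse_mor G \<sigma>"
  note i = inverse_morD[OF m]
  let ?T = "A (tgt G \<sigma>)" and ?D = "A (src G \<sigma>)"
  interpret T: ring ?T using m by (rule ring_tgt)
  interpret D: ring ?D using m by (intro unital_ring src_in_Obj)
  have D_unit: "\<beta> ?i \<sigma> \<in> Units ?D" using \<beta>_unit[OF i(7)] i by simp
  have D_cl: "\<beta> ?i \<sigma> \<in> carrier ?D" "inv\<^bsub>?D\<^esub> \<beta> ?i \<sigma> \<in> carrier ?D"
    using D_unit by auto
  have tri: "(\<sigma>, ?i, \<sigma>) \<in> composable_triples G"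
    using i m by (simp add: composable_triples_def)
  have "\<beta> \<sigma> ?i = \<alpha> \<sigma> (\<beta> ?i \<sigma>)"
    using \<beta>_cocycle[OF tri] i m \<beta>_tgt \<beta>_src \<beta>_closed[OF i(6)] D_cl \<alpha>_closed[OF i(6)] by simp
  then have "\<alpha> \<sigma> (inv\<^bsub>?D\<^esub> \<beta> ?i \<sigma>) \<otimes>\<^bsub>?T\<^esub> \<beta> \<sigma> ?i = \<alpha> \<sigma> (inv\<^bsub>?D\<^esub> \<beta> ?i \<sigma> \<otimes>\<^bsub>?D\<^esub> \<beta> ?i \<sigma>)"
    using \<alpha>_mult[OF i(6)] i D_cl by simp
  also have "\<dots> = \<one>\<^bsub>?T\<^esub>"
    using D_unit \<alpha>_one[OF i(6)] i by simp
  finally have inv_left: "\<alpha> \<sigma> (inv\<^bsub>?D\<^esub> \<beta> ?i \<sigma>) \<otimes>\<^bsub>?T\<^esub> \<beta> \<sigma> ?i = \<one>\<^bsub>?T\<^esub>" .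
  have "monomial G A \<one>\<^bsub>?T\<^esub> \<sigma> \<otimes>\<^bsub>P\<^esub> monomial G A (inv\<^bsub>?D\<^esub> \<beta> ?i \<sigma>) ?i =
      identity_of P (crossed_component G A (tgt G \<sigma>))"
    using monomial_mult[OF i(6)] D_cl i m inv_left \<alpha>_closed[OF i(6)]
    by (simp add: identity_of_crossed_component tgt_in_Obj)
  \<comment> \<open>In this order the cocycle identity does not enter: the coefficient is the
    inverse of \<open>\<beta>\<close> times the image of one times that same
    \<open>\<beta>\<close>.\<close>
  moreover have "monomial G A (inv\<^bsub>?D\<^esub> \<beta> ?i \<sigma>) ?i \<otimes>\<^bsub>P\<^esub> monomial G A \<one>\<^bsub>?T\<^esub> \<sigma> =
      identity_of P (crossed_component G A (src G \<sigma>))"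
    using monomial_mult[OF i(7)] D_cl D_unit i m \<alpha>_one[OF i(7)]
    by (simp add: identity_of_crossed_component src_in_Obj)
  ultimately show ?thesis
    using i m D_cl unfolding object_invertible_def
    by (auto simp: crossed_component_def intro!: bexI[of _ "monomial G A (inv\<^bsub>?D\<^esub> \<beta> ?i \<sigma>) ?i"])
qed

lemma crossed_product_object_crossed: "object_crossed_product G P (crossed_component G A)"
proof -
  interpret object_unital_graded_ring G P "crossed_component G A"
    by (rule crossed_product_object_unital)
  show ?thesis
    using monomial_one_invertible by unfold_locales (metis object_invertible_def)
qed

end


section \<open>Object crossed products arise from object crossed systems\<close>

context assoc_ring
begin

lemma mult_zero:
  assumes "x \<in> carrier R"
  shows "x \<otimes> \<zero> = \<zero>" "\<zero> \<otimes> x = \<zero>"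
proof -
  show "x \<otimes> \<zero> = \<zero>"
    using distrib_left[of "\<zero>" "\<zero>" x] assms mult_closed[of x "\<zero>"] add.l_cancel_one' by auto
  show "\<zero> \<otimes> x = \<zero>"
    using distrib_right[of "\<zero>" "\<zero>" x] assms mult_closed[of "\<zero>" x] add.l_cancel_one' by auto
qed

end

text \<open>The chosen elements \<open>u\<close> play the role of a section in the theory of group
  extensions. The normalization \<open>u_Obj\<close> is what makes the resulting action trivial at
  objects and the resulting cocycle normalized, and \<open>identity_nonzero\<close> makes the
  coefficient rings nonzero.\<close>

locale unit_section = object_crossed_product G R C
  for G :: "('g, 'x) category_data_scheme"
    and R :: "('r, 'k) ring_scheme" (structure)
    and C :: "'g \<Rightarrow> 'r set" +
  fixes u v :: "'g \<Rightarrow> 'r"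
  assumes identity_nonzero: "e \<in> Obj G \<Longrightarrow> identity_of R (C e) \<noteq> \<zero>"
    and u_comp: "\<sigma> \<in> Mor G \<Longrightarrow> u \<sigma> \<in> C \<sigma>"
    and v_comp: "\<sigma> \<in> Mor G \<Longrightarrow> v \<sigma> \<in> C (inverse_mor G \<sigma>)"
    and u_v: "\<sigma> \<in> Mor G \<Longrightarrow> u \<sigma> \<otimes> v \<sigma> = identity_of R (C (tgt G \<sigma>))"
    and v_u: "\<sigma> \<in> Mor G \<Longrightarrow> v \<sigma> \<otimes> u \<sigma> = identity_of R (C (src G \<sigma>))"
    and u_Obj: "e \<in> Obj G \<Longrightarrow> u e = identity_of R (C e)"
begin

section \<open>Calculus with homogeneous elements\<close>

abbreviation E :: "'g \<Rightarrow> 'r" where "E e \<equiv> identity_of R (C e)"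

lemma comp_closed: "\<sigma> \<in> Mor G \<Longrightarrow> x \<in> C \<sigma> \<Longrightarrow> x \<in> carrier R"
  using additive_subgroup.a_subset[OF component_subgroup] by blast

lemma comp_add: "\<sigma> \<in> Mor G \<Longrightarrow> x \<in> C \<sigma> \<Longrightarrow> y \<in> C \<sigma> \<Longrightarrow> x \<oplus> y \<in> C \<sigma>"
  using additive_subgroup.a_closed[OF component_subgroup] by blast

lemma comp_zero: "\<sigma> \<in> Mor G \<Longrightarrow> \<zero> \<in> C \<sigma>"
  using additive_subgroup.zero_closed[OF component_subgroup] by blast

lemma comp_neg: "\<sigma> \<in> Mor G \<Longrightarrow> x \<in> C \<sigma> \<Longrightarrow> \<ominus> x \<in> C \<sigma>"
  using subgroup.m_inv_closed[OF additive_subgroup.a_subgroup[OF component_subgroup]]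
  by (simp add: a_inv_def)

text \<open>The degree is a separate variable \<open>\<rho>\<close> tied to the composite by an
  equation, so the rule also applies where the composite is known under a simpler name.\<close>

lemma comp_mult:
  "\<sigma> \<in> Mor G \<Longrightarrow> \<tau> \<in> Mor G \<Longrightarrow> x \<in> C \<sigma> \<Longrightarrow> y \<in> C \<tau> \<Longrightarrow> src G \<sigma> = tgt G \<tau> \<Longrightarrow> \<sigma> \<cdot>\<^bsub>G\<^esub> \<tau> = \<rho> \<Longrightarrow>
    x \<otimes> y \<in> C \<rho>"
  using mult_composable[of \<sigma> \<tau> x y] by (auto simp: composable_pairs_def)

lemma E_comp: "e \<in> Obj G \<Longrightarrow> E e \<in> C e"
  using component_unital[of e] identity_of_eq is_identity_of_def by metis

lemma E_closed: "e \<in> Obj G \<Longrightarrow> E e \<in> carrier R"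
  using E_comp comp_closed[of e] by (auto simp: Obj_def)

text \<open>Rules by which local identities are absorbed. The object \<open>e\<close> is matched
  through an equation because it can occur as the source or target of various morphisms. The
  variants with a trailing \<open>y\<close> act inside products bracketed to the right, where the
  identity and its neighbour are not a subterm of their own.\<close>

lemma homogeneous_simps:
  assumes "\<tau> \<in> Mor G" "x \<in> C \<tau>"
  shows "x \<in> carrier R"
    and "e = tgt G \<tau> \<Longrightarrow> E e \<otimes> x = x"
    and "e = tgt G \<tau> \<Longrightarrow> y \<in> carrier R \<Longrightarrow> E e \<otimes> (x \<otimes> y) = x \<otimes> y"
    and "e = src G \<tau> \<Longrightarrow> x \<otimes> E e = x"
    and "e = src G \<tau> \<Longrightarrow> y \<in> carrier R \<Longrightarrow> x \<otimes> (E e \<otimes> y) = x \<otimes> y"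
proof -
  show x: "x \<in> carrier R" using assms by (rule comp_closed)
  show 1: "E e \<otimes> x = x" if "e = tgt G \<tau>" using that assms identity_mult by simp
  show 2: "x \<otimes> E e = x" if "e = src G \<tau>" using that assms mult_identity by simp
  show "E e \<otimes> (x \<otimes> y) = x \<otimes> y" if "e = tgt G \<tau>" "y \<in> carrier R"
    using that 1 x mult_assoc[of "E e" x y] assms by (simp add: E_closed tgt_in_Obj)
  show "x \<otimes> (E e \<otimes> y) = x \<otimes> y" if "e = src G \<tau>" "y \<in> carrier R"
    using that 2 x mult_assoc[of x "E e" y] assms by (simp add: E_closed src_in_Obj)
qed

lemmas u_simps = homogeneous_simps[OF _ u_comp]

lemma v_simps:
  assumes "\<sigma> \<in> Mor G"
  shows "v \<sigma> \<in> carrier R"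
    and "e = src G \<sigma> \<Longrightarrow> E e \<otimes> v \<sigma> = v \<sigma>"
    and "e = src G \<sigma> \<Longrightarrow> y \<in> carrier R \<Longrightarrow> E e \<otimes> (v \<sigma> \<otimes> y) = v \<sigma> \<otimes> y"
    and "e = tgt G \<sigma> \<Longrightarrow> v \<sigma> \<otimes> E e = v \<sigma>"
    and "e = tgt G \<sigma> \<Longrightarrow> y \<in> carrier R \<Longrightarrow> v \<sigma> \<otimes> (E e \<otimes> y) = v \<sigma> \<otimes> y"
  using homogeneous_simps[OF inverse_morD(1) v_comp] assms inverse_morD by simp_all

lemma cancel:
  assumes "\<sigma> \<in> Mor G" "y \<in> carrier R"
  shows "u \<sigma> \<otimes> (v \<sigma> \<otimes> y) = E (tgt G \<sigma>) \<otimes> y" "v \<sigma> \<otimes> (u \<sigma> \<otimes> y) = E (src G \<sigma>) \<otimes> y"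
  using assms mult_assoc[of "u \<sigma>" "v \<sigma>" y] mult_assoc[of "v \<sigma>" "u \<sigma>" y]
  by (simp_all add: u_simps v_simps u_v v_u)

text \<open>A normal form for words in \<open>u\<close>, \<open>v\<close> and coefficients: brackets
  move to the right, adjacent \<open>u \<sigma>\<close> and \<open>v \<sigma>\<close> collapse to a
  local identity, and local identities are absorbed by their neighbours. The identities for the
  action and the cocycle are settled by this rewriting.\<close>

lemmas normalize = mult_assoc mult_closed u_simps v_simps u_v v_u cancel E_closed tgt_in_Obj src_in_Obj

text \<open>Since \<open>u e\<close> is the identity of \<open>C e\<close>, the relation
  \<open>u e \<otimes> v e = E e\<close> already reads \<open>v e = E e\<close>.\<close>

lemma v_Obj: assumes e: "e \<in> Obj G" shows "v e = E e"
proof -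
  have m: "e \<in> Mor G" "src G e = e" using e by (auto simp: Obj_def)
  then show ?thesis using u_v[OF m(1)] u_Obj[OF e] Obj_tgt[OF e] v_simps(2)[OF m(1)] by simp
qed

section \<open>The object crossed system attached to the chosen section\<close>

definition coeff_ring :: "'g \<Rightarrow> 'r ring" where
  "coeff_ring e = \<lparr>carrier = C e, mult = (\<otimes>), one = E e, zero = \<zero>, add = (\<oplus>)\<rparr>"

definition act :: "'g \<Rightarrow> 'r \<Rightarrow> 'r" where
  "act \<sigma> a = u \<sigma> \<otimes> a \<otimes> v \<sigma>"

text \<open>This is the factor set of the section: it measures how far
  \<open>u \<sigma> \<otimes> u \<tau>\<close> is from \<open>u\<close> at the composite.\<close>

definition twist :: "'g \<Rightarrow> 'g \<Rightarrow> 'r" where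
  "twist \<sigma> \<tau> = u \<sigma> \<otimes> u \<tau> \<otimes> v (\<sigma> \<cdot>\<^bsub>G\<^esub> \<tau>)"

text \<open>All coefficient rings share the operations of \<open>R\<close>; only carrier and
  identity depend on the object. Under these rules the axioms of an object crossed system turn into
  identities between words in \<open>R\<close>.\<close>

lemma coeff_ring_simps [simp]:
  "carrier (coeff_ring e) = C e" "x \<otimes>\<^bsub>coeff_ring e\<^esub> y = x \<otimes> y" "\<one>\<^bsub>coeff_ring e\<^esub> = E e"
  "\<zero>\<^bsub>coeff_ring e\<^esub> = \<zero>" "x \<oplus>\<^bsub>coeff_ring e\<^esub> y = x \<oplus> y"
  by (simp_all add: coeff_ring_def)

lemma coeff_ring: assumes e: "e \<in> Obj G" shows "ring (coeff_ring e)"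
proof -
  have m: "e \<in> Mor G" "src G e = e" "tgt G e = e" "e \<cdot>\<^bsub>G\<^esub> e = e"
    using e Obj_tgt Obj_cmp by (auto simp: Obj_def)
  note cl = comp_closed[OF m(1)]
  show ?thesis
  proof (rule ringI)
    show "abelian_group (coeff_ring e)"
    proof (rule abelian_groupI)
      show "\<exists>y\<in>carrier (coeff_ring e). y \<oplus>\<^bsub>coeff_ring e\<^esub> x = \<zero>\<^bsub>coeff_ring e\<^esub>"
        if "x \<in> carrier (coeff_ring e)" for x
        using that cl[of x] comp_neg[OF m(1)] l_neg by (auto intro!: bexI[of _ "\<ominus> x"])
    qed (use m cl in \<open>auto simp: comp_add comp_zero a_ac\<close>)
    show "monoid (coeff_ring e)"
      by (rule monoidI)
        (use m cl e in \<open>auto simp: mult_assoc E_comp homogeneous_simps intro: comp_mult[of e e]\<close>)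
  qed (use cl in \<open>auto simp: distrib_left distrib_right\<close>)
qed

lemma u_mult_comp: "\<sigma> \<in> Mor G \<Longrightarrow> a \<in> C (src G \<sigma>) \<Longrightarrow> u \<sigma> \<otimes> a \<in> C \<sigma>"
  by (rule comp_mult[of \<sigma> "src G \<sigma>"]) (simp_all add: u_comp src_closed tgt_src cmp_src)

lemma mult_u_comp: "\<sigma> \<in> Mor G \<Longrightarrow> a \<in> C (tgt G \<sigma>) \<Longrightarrow> a \<otimes> u \<sigma> \<in> C \<sigma>"
  by (rule comp_mult[of "tgt G \<sigma>" \<sigma>]) (simp_all add: u_comp tgt_closed src_tgt tgt_cmp_self)

lemma mult_v_comp: "\<sigma> \<in> Mor G \<Longrightarrow> x \<in> C \<sigma> \<Longrightarrow> x \<otimes> v \<sigma> \<in> C (tgt G \<sigma>)"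
  by (rule comp_mult[of \<sigma> "inverse_mor G \<sigma>"]) (simp_all add: v_comp inverse_morD)

lemma v_mult_comp: "\<sigma> \<in> Mor G \<Longrightarrow> x \<in> C \<sigma> \<Longrightarrow> v \<sigma> \<otimes> x \<in> C (src G \<sigma>)"
  by (rule comp_mult[of "inverse_mor G \<sigma>" \<sigma>]) (simp_all add: v_comp inverse_morD)

lemma act_comp: "\<sigma> \<in> Mor G \<Longrightarrow> a \<in> C (src G \<sigma>) \<Longrightarrow> act \<sigma> a \<in> C (tgt G \<sigma>)"
  by (simp add: act_def mult_v_comp u_mult_comp)

lemma act_iso:
  assumes m: "\<sigma> \<in> Mor G"
  shows "act \<sigma> \<in> ring_iso (coeff_ring (src G \<sigma>)) (coeff_ring (tgt G \<sigma>))"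
proof (rule ring_iso_memI)
  note s = homogeneous_simps[OF src_closed[OF m]] and t = homogeneous_simps[OF tgt_closed[OF m]]
  fix x y assume xy: "x \<in> carrier (coeff_ring (src G \<sigma>))" "y \<in> carrier (coeff_ring (src G \<sigma>))"
  then have xy': "x \<in> C (src G \<sigma>)" "y \<in> C (src G \<sigma>)" by simp_all
  show "act \<sigma> x \<in> carrier (coeff_ring (tgt G \<sigma>))"
    using xy' act_comp m by simp
  show "act \<sigma> (x \<otimes>\<^bsub>coeff_ring (src G \<sigma>)\<^esub> y) = act \<sigma> x \<otimes>\<^bsub>coeff_ring (tgt G \<sigma>)\<^esub> act \<sigma> y"
    using m s[OF xy'(1)] s[OF xy'(2)] by (simp add: act_def normalize tgt_src src_src)
  show "act \<sigma> (x \<oplus>\<^bsub>coeff_ring (src G \<sigma>)\<^esub> y) = act \<sigma> x \<oplus>\<^bsub>coeff_ring (tgt G \<sigma>)\<^esub> act \<sigma> y"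
    using m s[OF xy'(1)] s[OF xy'(2)]
    by (simp add: act_def distrib_left distrib_right mult_closed u_simps v_simps)
next
  show "act \<sigma> \<one>\<^bsub>coeff_ring (src G \<sigma>)\<^esub> = \<one>\<^bsub>coeff_ring (tgt G \<sigma>)\<^esub>"
    using m by (simp add: act_def normalize)
next
  note s = homogeneous_simps[OF src_closed[OF m]] and t = homogeneous_simps[OF tgt_closed[OF m]]
  show "bij_betw (act \<sigma>) (carrier (coeff_ring (src G \<sigma>))) (carrier (coeff_ring (tgt G \<sigma>)))"
  \<comment> \<open>The inverse map is conjugation in the opposite direction, with
    \<open>v \<sigma>\<close> on the left and \<open>u \<sigma>\<close> on the right.\<close>
  proof (rule bij_betw_byWitness[where f' = "\<lambda>a. v \<sigma> \<otimes> (a \<otimes> u \<sigma>)"])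
    show "\<forall>a\<in>carrier (coeff_ring (src G \<sigma>)). v \<sigma> \<otimes> (act \<sigma> a \<otimes> u \<sigma>) = a"
      using m s by (auto simp: act_def normalize tgt_src src_src)
    show "\<forall>a\<in>carrier (coeff_ring (tgt G \<sigma>)). act \<sigma> (v \<sigma> \<otimes> (a \<otimes> u \<sigma>)) = a"
      using m t by (auto simp: act_def normalize tgt_tgt src_tgt)
  qed (use m act_comp v_mult_comp mult_u_comp in auto)
qed

lemma twist_comp: "(\<sigma>, \<tau>) \<in> composable_pairs G \<Longrightarrow> twist \<sigma> \<tau> \<in> C (tgt G \<sigma>)"
  using mult_v_comp[of "\<sigma> \<cdot>\<^bsub>G\<^esub> \<tau>" "u \<sigma> \<otimes> u \<tau>"] mult_composable[of \<sigma> \<tau> "u \<sigma>" "u \<tau>"]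
  by (simp add: twist_def u_comp composable_pairsD)

text \<open>The word \<open>twist \<sigma> \<tau>\<close> read backwards, with \<open>u\<close> and
  \<open>v\<close> exchanged.\<close>

definition twist_inv :: "'g \<Rightarrow> 'g \<Rightarrow> 'r" where
  "twist_inv \<sigma> \<tau> = u (\<sigma> \<cdot>\<^bsub>G\<^esub> \<tau>) \<otimes> v \<tau> \<otimes> v \<sigma>"

lemma twist_inv:
  assumes c: "(\<sigma>, \<tau>) \<in> composable_pairs G"
  shows "twist_inv \<sigma> \<tau> \<in> C (tgt G \<sigma>)"
    and "twist \<sigma> \<tau> \<otimes> twist_inv \<sigma> \<tau> = E (tgt G \<sigma>)"
    and "twist_inv \<sigma> \<tau> \<otimes> twist \<sigma> \<tau> = E (tgt G \<sigma>)"
proof -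
  note d = composable_pairsD[OF c]
  note i = inverse_morD[OF d(2)]
  \<comment> \<open>This composite is the degree of
    \<open>u (\<sigma>\<tau>) \<otimes> v \<tau>\<close>. It reduces to \<open>\<sigma>\<close>, so
    a final factor \<open>v \<sigma>\<close> brings the word into degree
    \<open>tgt G \<sigma>\<close>.\<close>
  have "(\<sigma> \<cdot>\<^bsub>G\<^esub> \<tau>) \<cdot>\<^bsub>G\<^esub> inverse_mor G \<tau> = \<sigma> \<cdot>\<^bsub>G\<^esub> tgt G \<tau>"
    using c i cmp_assoc[of \<sigma> \<tau> "inverse_mor G \<tau>"] by (simp add: composable_triples_def)
  also have "\<dots> = \<sigma>"
    using d cmp_src[of \<sigma>] by simp
  finally have "u (\<sigma> \<cdot>\<^bsub>G\<^esub> \<tau>) \<otimes> v \<tau> \<in> C \<sigma>"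
    by (intro comp_mult[of "\<sigma> \<cdot>\<^bsub>G\<^esub> \<tau>" "inverse_mor G \<tau>"]) (use d i in \<open>simp_all add: u_comp v_comp\<close>)
  then show "twist_inv \<sigma> \<tau> \<in> C (tgt G \<sigma>)"
    using d by (simp add: twist_inv_def mult_v_comp)
  show "twist \<sigma> \<tau> \<otimes> twist_inv \<sigma> \<tau> = E (tgt G \<sigma>)" "twist_inv \<sigma> \<tau> \<otimes> twist \<sigma> \<tau> = E (tgt G \<sigma>)"
    using d by (simp_all add: twist_def twist_inv_def normalize)
qed

text \<open>Replaces the abstract inverse in the twisted composition law by an explicit word, which
  the normalization can then process.\<close>

lemma inv_twist:
  assumes c: "(\<sigma>, \<tau>) \<in> composable_pairs G"
  shows "inv\<^bsub>coeff_ring (tgt G \<sigma>)\<^esub> twist \<sigma> \<tau> = twist_inv \<sigma> \<tau>"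
proof -
  interpret A: ring "coeff_ring (tgt G \<sigma>)"
    using composable_pairsD[OF c] by (intro coeff_ring tgt_in_Obj)
  show ?thesis
    using twist_inv[OF c] twist_comp[OF c] by (intro A.inv_unique'[symmetric]) simp_all
qed

sublocale X: object_crossed_system G coeff_ring act twist
proof (intro object_crossed_system.intro object_crossed_system_axioms.intro groupoid_axioms)
  show "ring (coeff_ring e)" if "e \<in> Obj G" for e
    using that by (rule coeff_ring)
  show "carrier (coeff_ring e) \<noteq> {\<zero>\<^bsub>coeff_ring e\<^esub>}" if "e \<in> Obj G" for e
    using E_comp[OF that] identity_nonzero[OF that] by auto
  show "act \<sigma> \<in> ring_iso (coeff_ring (src G \<sigma>)) (coeff_ring (tgt G \<sigma>))" if "\<sigma> \<in> Mor G" for \<sigma>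
    using that by (rule act_iso)
  show "twist \<sigma> \<tau> \<in> Units (coeff_ring (tgt G \<sigma>))" if "(\<sigma>, \<tau>) \<in> composable_pairs G" for \<sigma> \<tau>
    using twist_inv[OF that] twist_comp[OF that] by (auto simp: Units_def)
  show "act e a = a" if "e \<in> Obj G" "a \<in> carrier (coeff_ring e)" for e a
  proof -
    have "e \<in> Mor G" "src G e = e" "a \<in> C e" using that by (auto simp: Obj_def)
    then show ?thesis
      using that(1) homogeneous_simps[of e a] by (simp add: act_def u_Obj v_Obj Obj_tgt)
  qed
  show "twist \<sigma> (src G \<sigma>) = \<one>\<^bsub>coeff_ring (tgt G \<sigma>)\<^esub>" if "\<sigma> \<in> Mor G" for \<sigma>
    using that by (simp add: twist_def u_Obj cmp_src normalize)
  show "twist (tgt G \<sigma>) \<sigma> = \<one>\<^bsub>coeff_ring (tgt G \<sigma>)\<^esub>" if "\<sigma> \<in> Mor G" for \<sigma>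
    using that by (simp add: twist_def u_Obj tgt_cmp_self normalize)
  show "act \<sigma> (act \<tau> a) = twist \<sigma> \<tau> \<otimes>\<^bsub>coeff_ring (tgt G \<sigma>)\<^esub> act (\<sigma> \<cdot>\<^bsub>G\<^esub> \<tau>) a
      \<otimes>\<^bsub>coeff_ring (tgt G \<sigma>)\<^esub> inv\<^bsub>coeff_ring (tgt G \<sigma>)\<^esub> twist \<sigma> \<tau>"
    if c: "(\<sigma>, \<tau>) \<in> composable_pairs G" and a: "a \<in> carrier (coeff_ring (src G \<tau>))" for \<sigma> \<tau> a
  proof -
    note d = composable_pairsD[OF c]
    have a': "a \<in> C (src G \<tau>)" using a by simp
    \<comment> \<open>Both sides have the normal form
      \<open>u \<sigma> u \<tau> a v \<tau> v \<sigma>\<close>: on the right, the factors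
      \<open>u\<close> and \<open>v\<close> at the composite meet in adjacent pairs and
      cancel.\<close>
    show ?thesis
      using d homogeneous_simps[OF src_closed[OF d(2)] a']
      unfolding inv_twist[OF c]
      by (simp add: act_def twist_def twist_inv_def normalize tgt_src src_src)
  qed
  show "twist \<sigma> \<tau> \<otimes>\<^bsub>coeff_ring (tgt G \<sigma>)\<^esub> twist (\<sigma> \<cdot>\<^bsub>G\<^esub> \<tau>) \<rho> =
      act \<sigma> (twist \<tau> \<rho>) \<otimes>\<^bsub>coeff_ring (tgt G \<sigma>)\<^esub> twist \<sigma> (\<tau> \<cdot>\<^bsub>G\<^esub> \<rho>)"
    if t: "(\<sigma>, \<tau>, \<rho>) \<in> composable_triples G" for \<sigma> \<tau> \<rho>
  proof -
    have c: "(\<sigma>, \<tau>) \<in> composable_pairs G" "(\<tau>, \<rho>) \<in> composable_pairs G"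
      using t by (auto simp: composable_triples_def)
    note d = composable_pairsD[OF c(1)] and e = composable_pairsD[OF c(2)]
    \<comment> \<open>The goal is rewritten to the right bracketing of the triple composite, so its
      membership in \<open>Mor G\<close> is carried over to that form.\<close>
    have "(\<sigma> \<cdot>\<^bsub>G\<^esub> \<tau>) \<cdot>\<^bsub>G\<^esub> \<rho> \<in> Mor G"
      using d e by (intro cmp_closed) (simp add: composable_pairs_def)
    then have f: "\<sigma> \<cdot>\<^bsub>G\<^esub> (\<tau> \<cdot>\<^bsub>G\<^esub> \<rho>) \<in> Mor G"
      using cmp_assoc[OF t] by simp
    \<comment> \<open>Both sides normalize to \<open>u \<sigma> u \<tau> u \<rho>\<close> followed
      by \<open>v\<close> at the triple composite.\<close>
    show ?thesis
      using d e f by (simp add: act_def twist_def normalize cmp_assoc[OF t])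
  qed
qed

section \<open>Formal sums read as sums in \<open>R\<close>\<close>

definition realize :: "('g \<Rightarrow> 'r) \<Rightarrow> 'r" where
  "realize a = (\<Oplus>\<sigma>\<in>support G coeff_ring a. a \<sigma> \<otimes> u \<sigma>)"

lemma P_comp: "a \<in> carrier X.P \<Longrightarrow> \<sigma> \<in> Mor G \<Longrightarrow> a \<sigma> \<in> C (tgt G \<sigma>)"
  using X.P_closed by simp

lemma P_term_closed: "a \<in> carrier X.P \<Longrightarrow> \<sigma> \<in> Mor G \<Longrightarrow> a \<sigma> \<otimes> u \<sigma> \<in> carrier R"
  using P_comp mult_u_comp comp_closed by blast

text \<open>Degrees outside the support contribute zero. Hence formal sums with different supports
  can be compared over one common range, as additivity requires.\<close>

lemma realize_eq:
  assumes a: "a \<in> carrier X.P" and F: "finite F" "support G coeff_ring a \<subseteq> F" "F \<subseteq> Mor G"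
  shows "realize a = (\<Oplus>\<sigma>\<in>F. a \<sigma> \<otimes> u \<sigma>)"
  unfolding realize_def
proof (rule add.finprod_mono_neutral_cong_left)
  show "a \<sigma> \<otimes> u \<sigma> = \<zero>" if "\<sigma> \<in> F - support G coeff_ring a" for \<sigma>
    using that F by (auto simp: support_def mult_zero u_simps)
qed (use F P_term_closed[OF a] in auto)

lemma realize_closed: "a \<in> carrier X.P \<Longrightarrow> realize a \<in> carrier R"
  unfolding realize_def using X.support_subset[of a]
  by (intro finsum_closed) (auto intro!: P_term_closed)

lemma realize_add:
  assumes a: "a \<in> carrier X.P" and b: "b \<in> carrier X.P"
  shows "realize (a \<oplus>\<^bsub>X.P\<^esub> b) = realize a \<oplus> realize b"
proof -
  let ?F = "support G coeff_ring a \<union> support G coeff_ring b"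
  have F: "finite ?F" "?F \<subseteq> Mor G"
    using X.support_finite[OF a] X.support_finite[OF b] by (auto simp: X.support_subset)
  have "realize (a \<oplus>\<^bsub>X.P\<^esub> b) = (\<Oplus>\<sigma>\<in>?F. (a \<oplus>\<^bsub>X.P\<^esub> b) \<sigma> \<otimes> u \<sigma>)"
    using F X.support_add a b by (intro realize_eq) (auto simp: X.P_add_closed)
  also have "\<dots> = (\<Oplus>\<sigma>\<in>?F. a \<sigma> \<otimes> u \<sigma> \<oplus> b \<sigma> \<otimes> u \<sigma>)"
  proof (rule finsum_cong')
    fix \<sigma> assume "\<sigma> \<in> ?F"
    then have m: "\<sigma> \<in> Mor G" using F by blast
    show "(a \<oplus>\<^bsub>X.P\<^esub> b) \<sigma> \<otimes> u \<sigma> = a \<sigma> \<otimes> u \<sigma> \<oplus> b \<sigma> \<otimes> u \<sigma>"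
      using m comp_closed[OF tgt_closed[OF m]] P_comp[OF a m] P_comp[OF b m]
      by (simp add: X.P_add_apply distrib_right u_simps)
  qed (use F in \<open>auto intro!: P_term_closed a b\<close>)
  also have "\<dots> = (\<Oplus>\<sigma>\<in>?F. a \<sigma> \<otimes> u \<sigma>) \<oplus> (\<Oplus>\<sigma>\<in>?F. b \<sigma> \<otimes> u \<sigma>)"
    by (rule finsum_addf) (use F in \<open>auto intro!: P_term_closed a b\<close>)
  also have "\<dots> = realize a \<oplus> realize b"
    using F realize_eq[OF a, of ?F] realize_eq[OF b, of ?F] by simp
  finally show ?thesis .
qed

lemma realize_zero: "realize \<zero>\<^bsub>X.P\<^esub> = \<zero>"
proof -
  have "support G coeff_ring \<zero>\<^bsub>X.P\<^esub> = {}"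
    by (auto simp: support_def X.P_zero_apply)
  then show ?thesis by (simp add: realize_def)
qed

lemma realize_monomial:
  assumes m: "\<sigma> \<in> Mor G" and a: "a \<in> C (tgt G \<sigma>)"
  shows "realize (monomial G coeff_ring a \<sigma>) = a \<otimes> u \<sigma>"
proof -
  have cl: "a \<otimes> u \<sigma> \<in> carrier R" using m a by (intro comp_closed[OF m] mult_u_comp)
  have "realize (monomial G coeff_ring a \<sigma>) = (\<Oplus>\<tau>\<in>{\<sigma>}. monomial G coeff_ring a \<sigma> \<tau> \<otimes> u \<tau>)"
    using m a by (intro realize_eq X.monomial_closed)
      (auto simp: support_def X.monomial_apply split: if_splits)
  also have "\<dots> = a \<otimes> u \<sigma>"
    using m cl by (simp add: X.monomial_apply)
  finally show ?thesis .
qed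

text \<open>In the composable case the coefficient
  \<open>a \<otimes> act \<sigma> b \<otimes> twist \<sigma> \<tau>\<close> times \<open>u\<close>
  at the composite contains \<open>v \<sigma> \<otimes> u \<sigma>\<close> and
  \<open>v \<otimes> u\<close> at the composite; both collapse. Otherwise both sides are zero, on
  the right by the grading of \<open>R\<close>.\<close>

lemma realize_monomial_mult:
  assumes m: "\<sigma> \<in> Mor G" "\<tau> \<in> Mor G" and a: "a \<in> C (tgt G \<sigma>)" and b: "b \<in> C (tgt G \<tau>)"
  shows "realize (monomial G coeff_ring a \<sigma> \<otimes>\<^bsub>X.P\<^esub> monomial G coeff_ring b \<tau>) =
    a \<otimes> u \<sigma> \<otimes> (b \<otimes> u \<tau>)"
proof (cases "(\<sigma>, \<tau>) \<in> composable_pairs G")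
  case True
  note d = composable_pairsD[OF True]
  interpret T: ring "coeff_ring (tgt G \<sigma>)" using m by (intro coeff_ring tgt_in_Obj)
  have "act \<sigma> b \<in> C (tgt G \<sigma>)" using act_comp[OF m(1)] b d by simp
  then have "a \<otimes> act \<sigma> b \<otimes> twist \<sigma> \<tau> \<in> C (tgt G \<sigma>)"
    using a twist_comp[OF True] T.m_closed by simp
  then show ?thesis
    using d a b X.monomial_mult[OF True, of a b] homogeneous_simps[OF tgt_closed[OF m(1)] a]
      homogeneous_simps[OF tgt_closed[OF m(2)] b]
    by (simp add: realize_monomial) (simp add: act_def twist_def normalize tgt_tgt src_tgt)
next
  case False
  then show ?thesis
    using m a b mult_not_composable[OF m False mult_u_comp mult_u_comp]
    by (simp add: X.monomial_mult_not_composable realize_zero)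
qed

text \<open>Both sides are biadditive, so the monomial case is extended first in \<open>y\<close>
  and then in \<open>x\<close>.\<close>

lemma realize_mult:
  assumes x: "x \<in> carrier X.P" and y: "y \<in> carrier X.P"
  shows "realize (x \<otimes>\<^bsub>X.P\<^esub> y) = realize x \<otimes> realize y"
proof -
  have 1: "realize (monomial G coeff_ring a \<sigma> \<otimes>\<^bsub>X.P\<^esub> y) = realize (monomial G coeff_ring a \<sigma>) \<otimes> realize y"
    if m: "\<sigma> \<in> Mor G" "a \<in> carrier (coeff_ring (tgt G \<sigma>))" for a \<sigma>
    using y
  proof (induction y rule: X.P_induct)
    case (monomial \<tau> b)
    then show ?case using m by (simp add: realize_monomial_mult realize_monomial)
  qed (use m in \<open>simp_all add: X.P_mult_zero X.P_distrib_left X.P_mult_closed X.monomial_closed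
      realize_add realize_zero realize_closed mult_zero distrib_left\<close>)
  show ?thesis using x
  proof (induction x rule: X.P_induct)
    case (monomial \<sigma> a)
    then show ?case by (rule 1)
  qed (simp_all add: X.P_mult_zero X.P_distrib_right X.P_mult_closed
      realize_add realize_zero realize_closed mult_zero distrib_right y)
qed

text \<open>Together with \<open>term_mult_u\<close> this shows that right multiplication by
  \<open>u \<sigma>\<close> and by \<open>v \<sigma>\<close> are mutually inverse between
  \<open>C (tgt G \<sigma>)\<close> and \<open>C \<sigma>\<close>; every component is a free left
  module on \<open>u \<sigma>\<close>.\<close>

lemma term_mult_v: "\<sigma> \<in> Mor G \<Longrightarrow> a \<in> C (tgt G \<sigma>) \<Longrightarrow> a \<otimes> u \<sigma> \<otimes> v \<sigma> = a"
  using homogeneous_simps[OF tgt_closed, of \<sigma> a] by (simp add: normalize src_tgt)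

lemma term_mult_u: "\<sigma> \<in> Mor G \<Longrightarrow> x \<in> C \<sigma> \<Longrightarrow> x \<otimes> v \<sigma> \<otimes> u \<sigma> = x"
  using homogeneous_simps[of \<sigma> x] by (simp add: normalize)

section \<open>Bijectivity and the graded isomorphism\<close>

definition decomposes :: "'r \<Rightarrow> ('g \<Rightarrow> 'r) \<Rightarrow> bool" where
  "decomposes x f \<longleftrightarrow> f \<in> (\<Pi>\<^sub>E \<sigma>\<in>Mor G. C \<sigma>) \<and> finite {\<sigma> \<in> Mor G. f \<sigma> \<noteq> \<zero>} \<and>
    x = (\<Oplus>\<sigma>\<in>{\<sigma> \<in> Mor G. f \<sigma> \<noteq> \<zero>}. f \<sigma>)"

text \<open>With the predicate of \<open>direct_sum\<close> named, its uniqueness part can be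
  applied to two explicit decompositions.\<close>

lemma decomposition_unique:
  "x \<in> carrier R \<Longrightarrow> decomposes x f \<Longrightarrow> decomposes x g \<Longrightarrow> f = g"
  using direct_sum[of x, folded decomposes_def] by blast

lemma realize_decomposition:
  assumes a: "a \<in> carrier X.P"
  shows "decomposes (realize a) (\<lambda>\<sigma>\<in>Mor G. a \<sigma> \<otimes> u \<sigma>)"
proof -
  define f where "f = (\<lambda>\<sigma>\<in>Mor G. a \<sigma> \<otimes> u \<sigma>)"
  \<comment> \<open>The decomposition is summed over exactly the nonzero parts, so the support must
    match precisely; multiplying by \<open>v \<sigma>\<close> shows that no nonzero coefficient is
    lost.\<close>
  have "f \<sigma> = \<zero> \<longleftrightarrow> a \<sigma> = \<zero>" if m: "\<sigma> \<in> Mor G" for \<sigma>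
    using term_mult_v[OF m P_comp[OF a m]] m by (auto simp: f_def mult_zero u_simps v_simps)
  then have supp: "{\<sigma> \<in> Mor G. f \<sigma> \<noteq> \<zero>} = support G coeff_ring a"
    by (auto simp: support_def)
  have "realize a = (\<Oplus>\<sigma>\<in>support G coeff_ring a. f \<sigma>)"
    unfolding realize_def using X.support_subset[of a]
    by (intro finsum_cong') (auto simp: f_def intro!: P_term_closed a)
  moreover have "f \<in> (\<Pi>\<^sub>E \<sigma>\<in>Mor G. C \<sigma>)"
    by (auto simp: f_def intro!: mult_u_comp P_comp a)
  ultimately show ?thesis
    using X.support_finite[OF a] by (simp add: decomposes_def f_def[symmetric] supp)
qed

lemma realize_bij: "bij_betw realize (carrier X.P) (carrier R)"
proof (rule bij_betw_imageI)
  show "inj_on realize (carrier X.P)"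
  proof (rule inj_onI)
    fix a b assume a: "a \<in> carrier X.P" and b: "b \<in> carrier X.P" and eq: "realize a = realize b"
    \<comment> \<open>Equal images provide two decompositions of one element of \<open>R\<close>;
      comparing degrees and cancelling \<open>u \<sigma>\<close> recovers the coefficients.\<close>
    have fg: "(\<lambda>\<sigma>\<in>Mor G. a \<sigma> \<otimes> u \<sigma>) = (\<lambda>\<sigma>\<in>Mor G. b \<sigma> \<otimes> u \<sigma>)"
      using realize_decomposition[OF a] realize_decomposition[OF b, folded eq]
      by (rule decomposition_unique[OF realize_closed[OF a]])
    show "a = b"
    proof (rule X.P_ext[OF a b])
      fix \<sigma> assume m: "\<sigma> \<in> Mor G"
      have "a \<sigma> \<otimes> u \<sigma> = b \<sigma> \<otimes> u \<sigma>" using fun_cong[OF fg, of \<sigma>] m by simp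
      then show "a \<sigma> = b \<sigma>"
        using term_mult_v[OF m P_comp[OF a m]] term_mult_v[OF m P_comp[OF b m]] by metis
    qed
  qed
  show "realize ` carrier X.P = carrier R"
  proof
    show "realize ` carrier X.P \<subseteq> carrier R" using realize_closed by blast
    show "carrier R \<subseteq> realize ` carrier X.P"
    proof
      fix x assume "x \<in> carrier R"
      then obtain f where f: "f \<in> (\<Pi>\<^sub>E \<sigma>\<in>Mor G. C \<sigma>)" "finite {\<sigma> \<in> Mor G. f \<sigma> \<noteq> \<zero>}"
        and x: "x = (\<Oplus>\<sigma>\<in>{\<sigma> \<in> Mor G. f \<sigma> \<noteq> \<zero>}. f \<sigma>)"
        using direct_sum by blast
      let ?F = "{\<sigma> \<in> Mor G. f \<sigma> \<noteq> \<zero>}"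
      \<comment> \<open>Each homogeneous part is divided on the right by \<open>u \<sigma>\<close>,
        which puts its coefficient into \<open>C (tgt G \<sigma>)\<close>.\<close>
      define a where "a = (\<lambda>\<sigma>\<in>Mor G. f \<sigma> \<otimes> v \<sigma>)"
      have fC: "f \<sigma> \<in> C \<sigma>" if "\<sigma> \<in> Mor G" for \<sigma> using f(1) that by auto
      have supp: "support G coeff_ring a \<subseteq> ?F"
        by (auto simp: support_def a_def mult_zero v_simps)
      then have aP: "a \<in> carrier X.P"
        using finite_subset[OF supp f(2)] fC by (auto simp: X.P_carrier_iff a_def mult_v_comp)
      have "realize a = (\<Oplus>\<sigma>\<in>?F. a \<sigma> \<otimes> u \<sigma>)"
        by (rule realize_eq[OF aP f(2) supp]) auto
      also have "\<dots> = x"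
        unfolding x using fC comp_closed by (intro finsum_cong') (auto simp: a_def term_mult_u)
      finally show "x \<in> realize ` carrier X.P" using aP by blast
    qed
  qed
qed

lemma realize_component:
  assumes m: "\<sigma> \<in> Mor G"
  shows "realize ` crossed_component G coeff_ring \<sigma> = C \<sigma>"
proof
  show "realize ` crossed_component G coeff_ring \<sigma> \<subseteq> C \<sigma>"
    using m by (auto simp: crossed_component_def realize_monomial mult_u_comp)
  show "C \<sigma> \<subseteq> realize ` crossed_component G coeff_ring \<sigma>"
  proof
    fix x assume x: "x \<in> C \<sigma>"
    have "x = realize (monomial G coeff_ring (x \<otimes> v \<sigma>) \<sigma>)"
      using m x by (simp add: realize_monomial mult_v_comp term_mult_u)
    moreover have "monomial G coeff_ring (x \<otimes> v \<sigma>) \<sigma> \<in> crossed_component G coeff_ring \<sigma>"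
      using m x by (simp add: crossed_component_def mult_v_comp)
    ultimately show "x \<in> realize ` crossed_component G coeff_ring \<sigma>" by (rule image_eqI)
  qed
qed

text \<open>The isomorphism is wanted from \<open>R\<close> to the crossed product, so the inverse
  of \<open>realize\<close> is taken and its properties are transported back.\<close>

lemma inv_realize_graded_iso:
  "inv_into (carrier X.P) realize \<in> graded_ring_iso G R C X.P (crossed_component G coeff_ring)"
proof -
  interpret PA: abelian_group X.P by (rule X.P_abelian_group)
  let ?h = "inv_into (carrier X.P) realize"
  note inj = bij_betw_imp_inj_on[OF realize_bij] and img = bij_betw_imp_surj_on[OF realize_bij]
  have "realize \<in> iso (add_monoid X.P) (add_monoid R)"
    using realize_bij by (auto simp: iso_def hom_def realize_closed realize_add)
  then have "?h \<in> iso (add_monoid R) (add_monoid X.P)"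
    using PA.add.iso_set_sym by simp
  moreover have "?h \<in> hom R X.P"
  proof (rule homI)
    fix x y assume xy: "x \<in> carrier R" "y \<in> carrier R"
    show "?h x \<in> carrier X.P" using xy img by (simp add: inv_into_into)
    have cl: "?h x \<in> carrier X.P" "?h y \<in> carrier X.P" using xy img by (simp_all add: inv_into_into)
    \<comment> \<open>Applying the inverse of \<open>realize\<close> to this equation gives
      multiplicativity, since the argument on the right lies in the carrier.\<close>
    have "x \<otimes> y = realize (?h x \<otimes>\<^bsub>X.P\<^esub> ?h y)"
      using xy img cl by (simp add: realize_mult f_inv_into_f)
    then show "?h (x \<otimes> y) = ?h x \<otimes>\<^bsub>X.P\<^esub> ?h y"
      using inj cl by (simp add: X.P_mult_closed)
  qed
  moreover have "?h ` C \<sigma> = crossed_component G coeff_ring \<sigma>" if m: "\<sigma> \<in> Mor G" for \<sigma>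
  proof -
    have "crossed_component G coeff_ring \<sigma> \<subseteq> carrier X.P"
      using additive_subgroup.a_subset[OF X.crossed_component_subgroup[OF m]] .
    then show ?thesis
      using inv_into_image_cancel[OF inj] realize_component[OF m] by metis
  qed
  ultimately show ?thesis by (simp add: graded_ring_iso_def)
qed

end

lemma (in object_crossed_product) unit_section_exists:
  assumes "\<And>e. e \<in> Obj G \<Longrightarrow> identity_of R (C e) \<noteq> \<zero>"
  shows "\<exists>u v. unit_section G R C u v"
proof -
  have "\<exists>x y. x \<in> C \<sigma> \<and> y \<in> C (inverse_mor G \<sigma>) \<and> x \<otimes> y = identity_of R (C (tgt G \<sigma>)) \<and>
      y \<otimes> x = identity_of R (C (src G \<sigma>)) \<and> (\<sigma> \<in> Obj G \<longrightarrow> x = identity_of R (C \<sigma>))"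
    if m: "\<sigma> \<in> Mor G" for \<sigma>
  proof (cases "\<sigma> \<in> Obj G")
    \<comment> \<open>At an object the element is prescribed rather than chosen: the identity of the
      component is its own inverse there, because an identity morphism is its own inverse in the
      groupoid.\<close>
    case True
    then have "is_inverse G \<sigma> \<sigma>"
      using m Obj_tgt Obj_cmp by (auto simp: is_inverse_def composable_pairs_def Obj_def)
    then have i: "inverse_mor G \<sigma> = \<sigma>"
      using inverse_unique is_inverse_inverse_mor[OF m] by blast
    have "is_identity_of R (C \<sigma>) (identity_of R (C \<sigma>))"
      using component_unital[OF True] identity_of_eq by metis
    then show ?thesis
      using True i Obj_tgt[OF True] unfolding is_identity_of_def Obj_def by auto
  next
    case False
    then show ?thesis
      using invertible_exists[OF m] by (auto simp: object_invertible_def)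
  qed
  then obtain u v where "\<And>\<sigma>. \<sigma> \<in> Mor G \<Longrightarrow> u \<sigma> \<in> C \<sigma> \<and> v \<sigma> \<in> C (inverse_mor G \<sigma>) \<and>
      u \<sigma> \<otimes> v \<sigma> = identity_of R (C (tgt G \<sigma>)) \<and> v \<sigma> \<otimes> u \<sigma> = identity_of R (C (src G \<sigma>)) \<and>
      (\<sigma> \<in> Obj G \<longrightarrow> u \<sigma> = identity_of R (C \<sigma>))"
    by metis
  then have "unit_section G R C u v"
    using assms by unfold_locales (auto simp: Obj_def)
  then show ?thesis by blast
qed

theorem proposition16:
  fixes G :: "('g, 'x) category_data_scheme"
  assumes "groupoid G"
  shows "(\<forall>(A :: 'g \<Rightarrow> ('a, 'm) ring_scheme) \<alpha> \<beta>.
            object_crossed_system G A \<alpha> \<beta> \<longrightarrow>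
              object_unital_graded_ring G (crossed_product G A \<alpha> \<beta>) (crossed_component G A) \<and>
              object_crossed_product G (crossed_product G A \<alpha> \<beta>) (crossed_component G A)) \<and>
         (\<forall>(R :: ('r, 'k) ring_scheme) C.
            object_unital_graded_ring G R C \<and>
            (\<forall>e\<in>Obj G. identity_of R (C e) \<noteq> \<zero>\<^bsub>R\<^esub>) \<and>
            object_crossed_product G R C \<longrightarrow>
              (\<exists>(A :: 'g \<Rightarrow> 'r ring) \<alpha> \<beta>.
                 object_crossed_system G A \<alpha> \<beta> \<and>
                 graded_ring_iso G R C (crossed_product G A \<alpha> \<beta>) (crossed_component G A) \<noteq> {}))"
proof (intro conjI allI impI)
  fix A :: "'g \<Rightarrow> ('a, 'm) ring_scheme" and \<alpha> \<beta>
  assume "object_crossed_system G A \<alpha> \<beta>"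
  then show "object_unital_graded_ring G (crossed_product G A \<alpha> \<beta>) (crossed_component G A)"
    and "object_crossed_product G (crossed_product G A \<alpha> \<beta>) (crossed_component G A)"
    by (rule object_crossed_system.crossed_product_object_unital
        object_crossed_system.crossed_product_object_crossed)+
next
  fix R :: "('r, 'k) ring_scheme" and C
  assume h: "object_unital_graded_ring G R C \<and> (\<forall>e\<in>Obj G. identity_of R (C e) \<noteq> \<zero>\<^bsub>R\<^esub>) \<and>
    object_crossed_product G R C"
  then obtain u v where "unit_section G R C u v"
    using object_crossed_product.unit_section_exists[of G R C] by blast
  then interpret unit_section G R C u v .
  show "\<exists>(A :: 'g \<Rightarrow> 'r ring) \<alpha> \<beta>. object_crossed_system G A \<alpha> \<beta> \<and>
    graded_ring_iso G R C (crossed_product G A \<alpha> \<beta>) (crossed_component G A) \<noteq> {}"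
    using X.object_crossed_system_axioms inv_realize_graded_iso by blast
qed

end
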